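(* Let $d\ge 2$, $\lambda\in(0,\infty)$, let $X$ be a homogeneous Poisson point process in $\mathbb{R}^d$ with intensity $\lambda$, and let $Y^{(1)}$ be a stationary and ergodic point process in $\mathbb{R}^d$, independent of $X$, with intensity $\lambda'\in(0,\infty)$. Let $k\ge1$ be an integer and $r>0$. Then, almost surely, $$\Theta(k,r)=\lim_{n\to\infty}\lambda^{-1}n^{-d}\,\#\{X_i\in X\cap[-n/2,n/2]^d:\ H_r(X_i)\le k\}.$$
   Context: Point processes are regarded as random locally finite subsets of $\mathbb{R}^d$; $|\cdot|$ is the Euclidean norm. Put $Y=rY^{(1)}=\{ry:y\in Y^{(1)}\}$. For an integer $k\ge1$, two points $x,y\in\mathbb{R}^d$ are $k$-connectable if there exist (not necessarily distinct) $X_{i_1},\ldots,X_{i_{k-1}}\in X$ such that $|X_{i_j}-X_{i_{j+1}}|\le1$ for all $j\in\{0,\ldots,k-1\}$, where $X_{i_0}=x$ and $X_{i_k}=y$. For $x\in\mathbb{R}^d$, $H_r(x)$ is the smallest $k\ge1$ such that $x$ is $k$-connectable to some point of $Y=rY^{(1)}$ ($H_r(x)=\infty$ if there is no such $k$). Finally, $$\Theta(k,r)=\lambda^{-1}\,\mathbb{E}\,\#\{X_i\in X\cap[-1/2,1/2]^d:\ H_r(X_i)\le k\}.$$ *)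

theory Defs
  imports "HOL-Probability.Probability"
begin

definition loc_fin :: "(real^'n) set \<Rightarrow> bool" where
  "loc_fin A \<longleftrightarrow> (\<forall>B. bounded B \<longrightarrow> finite (A \<inter> B))"

definition cube :: "real \<Rightarrow> (real^'n) set" where
  "cube s = cbox (vec (- s / 2)) (vec (s / 2))"

text \<open>The space of locally finite sets carries the smallest sigma-algebra making all counting
  maps \<open>A \<mapsto> card (A \<inter> B)\<close>, with \<open>B\<close> bounded and Borel, measurable.\<close>

definition configs :: "(real^'n) set measure" where
  "configs = sigma (Collect loc_fin)
     {{A. loc_fin A \<and> card (A \<inter> B) = m} | B m. B \<in> sets borel \<and> bounded B}"

definition point_process :: "'w measure \<Rightarrow> ('w \<Rightarrow> (real^'n) set) \<Rightarrow> bool" where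
  "point_process M X \<longleftrightarrow> X \<in> measurable M configs"

text \<open>The null-set case \<open>measure lborel B = 0\<close> is the point mass at 0 (by \<open>0 ^ 0 = 1\<close>);
  this is why the mass function is written out: \<open>poisson_pmf\<close> requires a positive rate.\<close>

definition poisson_process :: "'w measure \<Rightarrow> real \<Rightarrow> ('w \<Rightarrow> (real^'n) set) \<Rightarrow> bool" where
  "poisson_process M lam X \<longleftrightarrow>
     point_process M X \<and>
     (\<forall>B m. B \<in> sets borel \<and> bounded B \<longrightarrow>
        measure M {\<omega> \<in> space M. card (X \<omega> \<inter> B) = m} =
          (lam * measure lborel B) ^ m / fact m * exp (- (lam * measure lborel B))) \<and>
     (\<forall>\<B>. finite \<B> \<and> disjoint \<B> \<and> (\<forall>B\<in>\<B>. B \<in> sets borel \<and> bounded B) \<longrightarrow>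
        prob_space.indep_vars M (\<lambda>_. count_space UNIV) (\<lambda>B \<omega>. card (X \<omega> \<inter> B)) \<B>)"

definition stationary :: "'w measure \<Rightarrow> ('w \<Rightarrow> (real^'n) set) \<Rightarrow> bool" where
  "stationary M Y \<longleftrightarrow>
     (\<forall>v. distr M configs (\<lambda>\<omega>. (+) v ` Y \<omega>) = distr M configs Y)"

definition shift_invariant :: "(real^'n) set set \<Rightarrow> bool" where
  "shift_invariant E \<longleftrightarrow> (\<forall>v. \<forall>A \<in> space configs. (+) v ` A \<in> E \<longleftrightarrow> A \<in> E)"

definition ergodic :: "'w measure \<Rightarrow> ('w \<Rightarrow> (real^'n) set) \<Rightarrow> bool" where
  "ergodic M Y \<longleftrightarrow>
     (\<forall>E \<in> sets configs. shift_invariant E \<longrightarrow>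
        measure M {\<omega> \<in> space M. Y \<omega> \<in> E} \<in> {0, 1})"

text \<open>Intended for stationary processes: the expected number of points in a unit cube.\<close>

definition intensity :: "'w measure \<Rightarrow> ('w \<Rightarrow> (real^'n) set) \<Rightarrow> ennreal" where
  "intensity M Y = (\<integral>\<^sup>+\<omega>. ennreal (real (card (Y \<omega> \<inter> cube 1))) \<partial>M)"

definition connectable :: "(real^'n) set \<Rightarrow> nat \<Rightarrow> real^'n \<Rightarrow> real^'n \<Rightarrow> bool" where
  "connectable A k x y \<longleftrightarrow>
     (\<exists>p :: nat \<Rightarrow> real^'n. p 0 = x \<and> p k = y \<and>
        (\<forall>j \<in> {1..<k}. p j \<in> A) \<and> (\<forall>j < k. norm (p j - p (Suc j)) \<le> 1))"

definition hops :: "(real^'n) set \<Rightarrow> (real^'n) set \<Rightarrow> real \<Rightarrow> real^'n \<Rightarrow> enat" where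
  "hops A S r x =
     (let P = \<lambda>k. 1 \<le> k \<and> (\<exists>y \<in> (\<lambda>z. r *\<^sub>R z) ` S. connectable A k x y)
      in if \<exists>k. P k then enat (LEAST k. P k) else \<infinity>)"

text \<open>The number of points of \<open>A\<close> in the centred cube of side length \<open>s\<close> that are
  at most \<open>k\<close> hops away from \<open>r S\<close>.\<close>

definition hop_count :: "(real^'n) set \<Rightarrow> (real^'n) set \<Rightarrow> nat \<Rightarrow> real \<Rightarrow> real \<Rightarrow> nat" where
  "hop_count A S k r s = card {x \<in> A \<inter> cube s. hops A S r x \<le> enat k}"

definition Theta ::
  "'w measure \<Rightarrow> real \<Rightarrow> ('w \<Rightarrow> (real^'n) set) \<Rightarrow> ('w \<Rightarrow> (real^'n) set) \<Rightarrow> nat \<Rightarrow> real \<Rightarrow> real" where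
  "Theta M lam X Y k r =
     inverse lam * prob_space.expectation M (\<lambda>\<omega>. real (hop_count (X \<omega>) (Y \<omega>) k r 1))"

end

theory Submission
  imports Defs "HOL-Real_Asymp.Real_Asymp"
begin

text \<open>Whether \<open>H_r(x) \<le> k\<close> depends on \<open>X\<close> only through its points within distance \<open>k\<close> of
  \<open>x\<close>. Fix the second process to be \<open>S\<close> and cut the cube of side \<open>n\<close> into \<open>(2n)^d\<close> cells of side 1/2: the counts in
  the cells have finite-range dependence, so the variance of the total is \<open>O(n^d)\<close>; as \<open>d \<ge> 2\<close>, the
  squared normalised deviations from the mean are summable, and the deviations vanish almost surely.
  The conditional mean of the total is the sum over cells of a bounded function of the translates of \<open>S\<close>.
  A pointwise ergodic theorem for averages of bounded functions over boxes of \<open>\<int>^d\<close> identifies the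
  limit: near-minimal \<open>L\<^sup>2\<close> norms make the averages \<open>L\<^sup>2\<close>-Cauchy (parallelogram law), a limit along an
  almost surely convergent subsequence is invariant under all real translations and hence constant by
  ergodicity, and a Vitali covering (weak-type maximal) inequality upgrades this to convergence of the
  full sequence.\<close>

subsection \<open>Measurability of point configurations\<close>

text \<open>Two obstacles shape the proof. Ergodicity under all real translations does not pass to
  the subgroup of lattice translations, so the lattice only supplies the averages; their limits are
  shown to be invariant under real translations because such a translation alters a sum over a box
  only near its boundary. And the fluctuation estimate is made for each fixed \<open>S\<close>, with
  bounds that do not depend on \<open>S\<close>; combining the two limits by Fubini requires joint
  measurability of the counts in both configurations, which is why measurability comes first. The
  side 1/2 is chosen so that for every n, odd or even, the (2n)^d half-open cells around the origin
  fill the cube of side n up to a null set. As moving \<open>S\<close> by v moves the target set by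
  r v, one cell corresponds to a shift of \<open>S\<close> by 1/(2r). The Poisson input enters
  through void probabilities, which determine the law and give stationarity and spatial
  independence, and through second moments of counts.\<close>

lemma loc_fin_subset: "loc_fin A \<Longrightarrow> B \<subseteq> A \<Longrightarrow> loc_fin B"
  unfolding loc_fin_def by (meson Int_mono finite_subset order_refl)

lemma loc_finD: "loc_fin A \<Longrightarrow> bounded B \<Longrightarrow> finite (A \<inter> B)"
  unfolding loc_fin_def by blast

lemma translate_Int: "(+) v ` A \<inter> B = (+) v ` (A \<inter> {x. v + x \<in> B})"
  for v :: "'a::ab_group_add"
  by blast

lemma bounded_translate_vimage: "bounded B \<Longrightarrow> bounded {x. v + x \<in> B}"
  for v :: "'a::real_normed_vector"
proof -
  assume "bounded B"
  moreover have "{x. v + x \<in> B} = (+) (- v) ` B"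
    by (auto simp: image_iff algebra_simps intro!: exI[of _ "v + _"] bexI[of _ "v + _"])
  ultimately show ?thesis
    using bounded_translation[of B "- v"] by simp
qed

lemma loc_fin_translate: "loc_fin A \<Longrightarrow> loc_fin ((+) v ` A)"
  unfolding loc_fin_def
  unfolding translate_Int by (intro allI impI finite_imageI) (simp add: bounded_translate_vimage)

lemma card_translate_Int: "card ((+) v ` A \<inter> B) = card (A \<inter> {x. v + x \<in> B})"
  for v :: "'a::ab_group_add"
  unfolding translate_Int by (rule card_image) (simp add: inj_on_def)

lemma space_configs: "space configs = Collect loc_fin"
  unfolding configs_def by (rule space_measure_of) auto

lemma card_Int_measurable:
  fixes B :: "(real^'n) set"
  assumes "B \<in> sets borel" "bounded B"
  shows "(\<lambda>A. card (A \<inter> B)) \<in> measurable configs (count_space UNIV)"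
proof -
  have "(\<lambda>A. card (A \<inter> B)) -` {m} \<inter> space configs \<in> sets configs" for m
  proof -
    have "(\<lambda>A. card (A \<inter> B)) -` {m} \<inter> space configs = {A. loc_fin A \<and> card (A \<inter> B) = m}"
      by (auto simp: space_configs)
    also have "\<dots> \<in> sets configs"
      unfolding configs_def using assms by (intro in_measure_of) auto
    finally show ?thesis .
  qed
  then show ?thesis
    by (subst measurable_count_space_eq2_countable) auto
qed

lemma measurable_configsI:
  fixes f :: "'a \<Rightarrow> (real^'n) set"
  assumes "\<And>\<omega>. \<omega> \<in> space N \<Longrightarrow> loc_fin (f \<omega>)"
    and "\<And>B. B \<in> sets borel \<Longrightarrow> bounded B \<Longrightarrow>
      (\<lambda>\<omega>. card (f \<omega> \<inter> B)) \<in> measurable N (count_space UNIV)"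
  shows "f \<in> measurable N configs"
  unfolding configs_def
proof (rule measurable_measure_of)
  show "f \<in> space N \<rightarrow> Collect loc_fin"
    using assms(1) by auto
  fix E :: "(real^'n) set set"
  assume "E \<in> {{A. loc_fin A \<and> card (A \<inter> B) = m} | B m. B \<in> sets borel \<and> bounded B}"
  then obtain B m where E: "E = {A. loc_fin A \<and> card (A \<inter> B) = m}" "B \<in> sets borel" "bounded B"
    by auto
  have "f -` E \<inter> space N = (\<lambda>\<omega>. card (f \<omega> \<inter> B)) -` {m} \<inter> space N"
    using assms(1) E by auto
  also have "\<dots> \<in> sets N"
    using assms(2)[OF E(2,3)] by (rule measurable_sets) auto
  finally show "f -` E \<inter> space N \<in> sets N" .
qed auto

lemma translate_measurable:
  fixes v :: "real^'n"
  shows "(\<lambda>A. (+) v ` A) \<in> measurable configs configs"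
proof (rule measurable_configsI)
  fix B :: "(real^'n) set" assume B: "B \<in> sets borel" "bounded B"
  have "{x. v + x \<in> B} \<in> sets borel"
    using measurable_sets[OF _ B(1), of "(+) v" borel] by (simp add: vimage_def)
  then show "(\<lambda>A. card ((+) v ` A \<inter> B)) \<in> measurable configs (count_space UNIV)"
    unfolding card_translate_Int
    using B by (intro card_Int_measurable bounded_translate_vimage)
qed (simp add: space_configs loc_fin_translate)

lemma Int_measurable:
  fixes B :: "(real^'n) set"
  shows "B \<in> sets borel \<Longrightarrow> (\<lambda>A. A \<inter> B) \<in> measurable configs configs"
proof (rule measurable_configsI)
  fix C :: "(real^'n) set" assume "C \<in> sets borel" "bounded C"
  moreover assume "B \<in> sets borel"
  ultimately show "(\<lambda>A. card (A \<inter> B \<inter> C)) \<in> measurable configs (count_space UNIV)"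
    unfolding Int_assoc by (intro card_Int_measurable) auto
qed (auto simp: space_configs intro: loc_fin_subset[OF _ Int_lower1])

text \<open>Dynkin's argument in \<open>Q\<close>: a rectangle factors into a count and an
  indicator, a complement subtracts from the total count in \<open>B\<close>, and a disjoint union
  gives a series. Boundedness of \<open>B\<close> keeps the counts finite, which the subtraction
  needs.\<close>

lemma card_select_measurable:
  fixes Z :: "'a \<Rightarrow> (real^'n) set"
  assumes Z: "Z \<in> measurable N configs" and B: "B \<in> sets borel" "bounded B"
    and Q: "Q \<in> sets (borel \<Otimes>\<^sub>M N)"
  shows "(\<lambda>\<omega>. real (card {p \<in> Z \<omega> \<inter> B. (p, \<omega>) \<in> Q})) \<in> borel_measurable N"
proof -
  have fin: "finite (Z \<omega> \<inter> B)" if "\<omega> \<in> space N" for \<omega>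
    using measurable_space[OF Z that] B by (auto simp: space_configs intro: loc_finD)
  have cnt: "(\<lambda>\<omega>. real (card (Z \<omega> \<inter> C))) \<in> borel_measurable N"
    if "C \<in> sets borel" "bounded C" for C
    using measurable_compose[OF Z card_Int_measurable[OF that]]
    by (rule measurable_compose) simp
  let ?G = "{a \<times> b | a b. a \<in> sets (borel :: (real^'n) measure) \<and> b \<in> sets N}"
  have "Q \<in> sigma_sets (UNIV \<times> space N) ?G"
    using Q by (simp add: sets_pair_measure)
  with Int_stable_pair_measure_generator[of borel N] pair_measure_closed[of borel N, simplified]
  show ?thesis
  proof (induction rule: sigma_sets_induct_disjoint)
    case (basic Q)
    then obtain a b where Q: "Q = a \<times> b" "a \<in> sets borel" "b \<in> sets N"
      by auto
    have "real (card {p \<in> Z \<omega> \<inter> B. (p, \<omega>) \<in> Q}) = real (card (Z \<omega> \<inter> (B \<inter> a))) * indicator b \<omega>" for \<omega>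
      by (auto simp: Q indicator_def Int_def conj_assoc)
    moreover have "(\<lambda>\<omega>. real (card (Z \<omega> \<inter> (B \<inter> a))) * indicator b \<omega>) \<in> borel_measurable N"
      using Q B by (intro borel_measurable_times cnt borel_measurable_indicator) (auto intro: bounded_Int)
    ultimately show ?case by simp
  next
    case empty
    show ?case by simp
  next
    case (compl Q)
    have "real (card {p \<in> Z \<omega> \<inter> B. (p, \<omega>) \<in> UNIV \<times> space N - Q})
        = real (card (Z \<omega> \<inter> B)) - real (card {p \<in> Z \<omega> \<inter> B. (p, \<omega>) \<in> Q})"
      if "\<omega> \<in> space N" for \<omega>
    proof -
      have "{p \<in> Z \<omega> \<inter> B. (p, \<omega>) \<in> UNIV \<times> space N - Q}
          = (Z \<omega> \<inter> B) - {p \<in> Z \<omega> \<inter> B. (p, \<omega>) \<in> Q}"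
        using that by auto
      moreover have "finite {p \<in> Z \<omega> \<inter> B. (p, \<omega>) \<in> Q}"
        using fin[OF that] by (rule rev_finite_subset) auto
      ultimately show ?thesis
        using fin[OF that] by (simp only:) (subst card_Diff_subset, auto simp: of_nat_diff intro!: of_nat_diff card_mono)
    qed
    moreover have "(\<lambda>\<omega>. real (card (Z \<omega> \<inter> B)) - real (card {p \<in> Z \<omega> \<inter> B. (p, \<omega>) \<in> Q}))
        \<in> borel_measurable N"
      using compl.IH cnt[OF B] by (rule borel_measurable_diff[rotated])
    ultimately show ?case by (simp cong: measurable_cong)
  next
    case (union D)
    have sums: "(\<lambda>i. real (card {p \<in> Z \<omega> \<inter> B. (p, \<omega>) \<in> D i})) sums real (card {p \<in> Z \<omega> \<inter> B. (p, \<omega>) \<in> (\<Union>i. D i)})"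
      if "\<omega> \<in> space N" for \<omega>
    proof -
      let ?C = "\<lambda>i. {p \<in> Z \<omega> \<inter> B. (p, \<omega>) \<in> D i}"
      \<comment> \<open>Countable additivity of \<open>card\<close> on subsets of one finite set,
        borrowed from the counting measure.\<close>
      have s: "(\<lambda>i. measure (count_space (Z \<omega> \<inter> B)) (?C i)) sums measure (count_space (Z \<omega> \<inter> B)) (\<Union>i. ?C i)"
        using fin[OF that] union(1)
        by (intro finite_measure.finite_measure_UNION finite_measure_count_space)
          (auto simp: disjoint_family_on_def)
      have m: "measure (count_space (Z \<omega> \<inter> B)) C = real (card C)" if "C \<subseteq> Z \<omega> \<inter> B" for C
        using that fin[OF \<open>\<omega> \<in> space N\<close>] finite_subset[OF that]
        by (simp add: measure_def emeasure_count_space)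
      have u: "(\<Union>i. ?C i) = {p \<in> Z \<omega> \<inter> B. (p, \<omega>) \<in> (\<Union>i. D i)}" "\<And>i. ?C i \<subseteq> Z \<omega> \<inter> B"
        "{p \<in> Z \<omega> \<inter> B. (p, \<omega>) \<in> (\<Union>i. D i)} \<subseteq> Z \<omega> \<inter> B"
        by blast+
      show ?thesis
        using s by (simp only: u(1) m[OF u(2)] m[OF u(3)])
    qed
    have "(\<Sum>i. real (card {p \<in> Z \<omega> \<inter> B. (p, \<omega>) \<in> D i})) = real (card {p \<in> Z \<omega> \<inter> B. (p, \<omega>) \<in> (\<Union>i. D i)})"
      if "\<omega> \<in> space N" for \<omega>
      by (rule sums_unique[OF sums[OF that], symmetric])
    moreover have "(\<lambda>\<omega>. \<Sum>i. real (card {p \<in> Z \<omega> \<inter> B. (p, \<omega>) \<in> D i})) \<in> borel_measurable N"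
      by (rule borel_measurable_suminf) (rule union.IH)
    ultimately show ?case
      by (subst measurable_cong[of N _ "\<lambda>\<omega>. \<Sum>i. real (card {p \<in> Z \<omega> \<inter> B. (p, \<omega>) \<in> D i})"]) auto
  qed
qed

text \<open>Since \<open>card\<close> of an infinite set is 0, existence cannot be read off a single
  global count; the space is exhausted by balls, in which all counts are finite.\<close>

lemma exists_point_measurable:
  fixes Z :: "'a \<Rightarrow> (real^'n) set"
  assumes Z: "Z \<in> measurable N configs" and Q: "Q \<in> sets (borel \<Otimes>\<^sub>M N)"
  shows "{\<omega> \<in> space N. \<exists>p \<in> Z \<omega>. (p, \<omega>) \<in> Q} \<in> sets N"
proof -
  let ?c = "\<lambda>m \<omega>. real (card {p \<in> Z \<omega> \<inter> cball 0 (real m). (p, \<omega>) \<in> Q})"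
  have "(\<exists>p \<in> Z \<omega>. (p, \<omega>) \<in> Q) \<longleftrightarrow> (\<exists>m. 0 < ?c m \<omega>)" if "\<omega> \<in> space N" for \<omega>
  proof -
    have "finite (Z \<omega> \<inter> cball 0 (real m))" for m
      using measurable_space[OF Z that] by (auto simp: space_configs intro: loc_finD)
    then have "0 < ?c m \<omega> \<longleftrightarrow> (\<exists>p \<in> Z \<omega> \<inter> cball 0 (real m). (p, \<omega>) \<in> Q)" for m
      by (subst of_nat_0_less_iff, subst card_gt_0_iff)
        (auto intro: finite_subset[of _ "Z \<omega> \<inter> cball 0 (real m)"])
    moreover have "\<exists>m. p \<in> cball 0 (real m)" for p :: "real^'n"
      by (simp add: real_arch_simple)
    ultimately show ?thesis by blast
  qed
  then have "{\<omega> \<in> space N. \<exists>p \<in> Z \<omega>. (p, \<omega>) \<in> Q} = (\<Union>m. {\<omega> \<in> space N. 0 < ?c m \<omega>})"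
    by auto
  also have "\<dots> \<in> sets N"
    by (intro sets.countable_UN image_subsetI borel_measurable_less borel_measurable_const
        card_select_measurable[OF Z _ _ Q]) auto
  finally show ?thesis .
qed

section \<open>Grid cells and void events\<close>

definition cell_index :: "real \<Rightarrow> real^'n \<Rightarrow> int^'n" where
  "cell_index m x = (\<chi> i. \<lfloor>m * x $ i\<rfloor>)"

lemma cell_index_borel: "{x. cell_index m x = z} \<in> sets borel"
proof -
  have "{x. cell_index m x = z} = {x. \<forall>i. \<lfloor>m * x $ i\<rfloor> = z $ i}"
    by (auto simp: cell_index_def vec_eq_iff)
  also have "\<dots> \<in> sets borel" by measurable
  finally show ?thesis .
qed

lemma finite_int_vec_box: "finite {z :: int^'n. \<forall>i. z $ i \<in> {a..b}}"
proof -
  have "{z :: int^'n. \<forall>i. z $ i \<in> {a..b}} \<subseteq> vec_lambda ` (UNIV \<rightarrow>\<^sub>E {a..b})"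
    by (auto simp: image_iff PiE_def intro!: exI[of _ "\<lambda>i. _ $ i"] bexI[of _ "\<lambda>i. _ $ i"])
  then show ?thesis
    by (rule finite_subset) (simp add: finite_PiE)
qed

lemma finite_cell_index_image:
  fixes B :: "(real^'n) set"
  assumes "bounded B"
  shows "finite (cell_index m ` B)"
proof -
  obtain K where K: "\<And>x. x \<in> B \<Longrightarrow> norm x \<le> K"
    using assms by (auto simp: bounded_iff)
  define c where "c = \<lceil>\<bar>m\<bar> * \<bar>K\<bar>\<rceil>"
  have "\<bar>m * x $ i\<bar> \<le> of_int c" if "x \<in> B" for x i
  proof -
    have "\<bar>m * x $ i\<bar> \<le> \<bar>m\<bar> * \<bar>K\<bar>"
      unfolding abs_mult using K[OF that] component_le_norm_cart[of x i]
      by (intro mult_left_mono) auto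
    then show ?thesis unfolding c_def by linarith
  qed
  then have "cell_index m ` B \<subseteq> {z. \<forall>i. z $ i \<in> {- c - 1..c + 1}}"
  proof safe
    fix x i assume "x \<in> B"
    then have "\<bar>m * x $ i\<bar> \<le> of_int c" by fact
    then show "cell_index m x $ i \<in> {- c - 1..c + 1}"
      unfolding cell_index_def by simp linarith
  qed
  then show ?thesis
    by (rule finite_subset) (rule finite_int_vec_box)
qed

text \<open>Distinct points differ in some coordinate, and equal cells of side 1/m force that
  difference below 1/m. A finite set needs only finitely many such comparisons.\<close>

lemma eventually_inj_on_cell_index:
  fixes A :: "(real^'n) set"
  assumes "finite A"
  shows "\<forall>\<^sub>F m in sequentially. inj_on (cell_index (real m)) A"
proof -
  have "\<forall>\<^sub>F m in sequentially. x \<noteq> y \<longrightarrow> cell_index (real m) x \<noteq> cell_index (real m) y"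
    for x y :: "real^'n"
  proof (cases "x = y")
    case False
    then obtain i where i: "x $ i \<noteq> y $ i" by (auto simp: vec_eq_iff)
    obtain m0 where m0: "1 / \<bar>x $ i - y $ i\<bar> < real m0"
      using reals_Archimedean2 by blast
    have "cell_index (real m) x \<noteq> cell_index (real m) y" if "m \<ge> m0" for m
    proof
      assume "cell_index (real m) x = cell_index (real m) y"
      then have "\<lfloor>real m * x $ i\<rfloor> = \<lfloor>real m * y $ i\<rfloor>"
        by (simp add: cell_index_def vec_eq_iff)
      then have "\<bar>real m * x $ i - real m * y $ i\<bar> < 1" by linarith
      then have "real m * \<bar>x $ i - y $ i\<bar> < 1"
        by (simp add: abs_mult flip: right_diff_distrib)
      moreover have "1 < real m0 * \<bar>x $ i - y $ i\<bar>"
        using m0 i by (simp add: field_simps)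
      moreover have "real m0 * \<bar>x $ i - y $ i\<bar> \<le> real m * \<bar>x $ i - y $ i\<bar>"
        using that by (intro mult_right_mono) auto
      ultimately show False by linarith
    qed
    then show ?thesis
      by (auto simp: eventually_sequentially)
  qed simp
  then have "\<forall>\<^sub>F m in sequentially. \<forall>x\<in>A. \<forall>y\<in>A. x \<noteq> y \<longrightarrow> cell_index (real m) x \<noteq> cell_index (real m) y"
    using assms by (simp add: eventually_ball_finite_distrib)
  then show ?thesis
    by (rule eventually_mono) (auto simp: inj_on_def)
qed

definition void_events :: "(real^'n) set set set" where
  "void_events = {{A. loc_fin A \<and> A \<inter> B = {}} | B. B \<in> sets borel \<and> bounded B}"

lemma Int_stable_void_events: "Int_stable void_events"
proof (rule Int_stableI)
  fix a b :: "(real^'n) set set" assume "a \<in> void_events" "b \<in> void_events"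
  then obtain B C where "a = {A. loc_fin A \<and> A \<inter> B = {}}" "b = {A. loc_fin A \<and> A \<inter> C = {}}"
    "B \<in> sets borel" "bounded B" "C \<in> sets borel" "bounded C"
    unfolding void_events_def by auto
  then have "a \<inter> b = {A. loc_fin A \<and> A \<inter> (B \<union> C) = {}}" and "B \<union> C \<in> sets borel" "bounded (B \<union> C)"
    by auto
  then show "a \<inter> b \<in> void_events"
    unfolding void_events_def by blast
qed

lemma void_events_Pow: "void_events \<subseteq> Pow (Collect loc_fin)"
  unfolding void_events_def by auto

text \<open>Configurations are sets, without multiplicities, so the number of points in
  \<open>B\<close> is the eventual value, as the mesh 1/m shrinks, of the number of grid cells that
  are hit inside \<open>B\<close>; a hit is the complement of a void event. With
  intersection-stability this shows that void probabilities determine the law of a random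
  configuration (Renyi).\<close>

lemma sets_configs_void: "sets (configs :: (real^'n) set measure) = sigma_sets (Collect loc_fin) void_events"
proof
  let ?V = "sigma (Collect loc_fin) (void_events :: (real^'n) set set set)"
  have spV: "space ?V = Collect loc_fin" and stV: "sets ?V = sigma_sets (Collect loc_fin) void_events"
    by (rule space_measure_of[OF void_events_Pow], rule sets_measure_of[OF void_events_Pow])
  have meas: "(\<lambda>A. card (A \<inter> B)) \<in> measurable ?V (count_space UNIV)"
    if B: "B \<in> sets borel" "bounded B" for B :: "(real^'n) set"
  proof -
    define s where "s m A = (\<Sum>c\<in>cell_index (real m) ` B.
        indicator {A. loc_fin A \<and> A \<inter> (B \<inter> {x. cell_index (real m) x = c}) \<noteq> {}} A :: real)"
      for m :: nat and A :: "(real^'n) set"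
    have hit: "{A. loc_fin A \<and> A \<inter> C \<noteq> {}} \<in> sets ?V" if "C \<in> sets borel" "bounded C" for C
    proof -
      have "{A. loc_fin A \<and> A \<inter> C = {}} \<in> sets ?V"
        unfolding stV using that by (intro sigma_sets.Basic) (auto simp: void_events_def)
      then have "space ?V - {A. loc_fin A \<and> A \<inter> C = {}} \<in> sets ?V" by auto
      also have "space ?V - {A. loc_fin A \<and> A \<inter> C = {}} = {A. loc_fin A \<and> A \<inter> C \<noteq> {}}"
        unfolding spV by auto
      finally show ?thesis .
    qed
    have s_meas: "s m \<in> borel_measurable ?V" for m
      unfolding s_def using B(2)
      by (intro borel_measurable_sum borel_measurable_indicator hit sets.Int B(1) cell_index_borel) auto
    have s_card: "s m A = real (card (cell_index (real m) ` (A \<inter> B)))" if "loc_fin A" for m A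
    proof -
      have fin: "finite (cell_index (real m) ` B)"
        using B by (intro finite_cell_index_image)
      have "A \<inter> (B \<inter> {x. cell_index (real m) x = c}) \<noteq> {} \<longleftrightarrow> c \<in> cell_index (real m) ` (A \<inter> B)" for c
        by blast
      then have "s m A = (\<Sum>c\<in>cell_index (real m) ` B. indicator (cell_index (real m) ` (A \<inter> B)) c)"
        unfolding s_def using that by (simp only: indicator_def mem_Collect_eq simp_thms)
      also have "\<dots> = real (card (cell_index (real m) ` B \<inter> cell_index (real m) ` (A \<inter> B)))"
        using sum.inter_restrict[OF fin, of "\<lambda>_. 1 :: real" "cell_index (real m) ` (A \<inter> B)"]
        unfolding indicator_def of_bool_def by simp
      also have "cell_index (real m) ` B \<inter> cell_index (real m) ` (A \<inter> B) = cell_index (real m) ` (A \<inter> B)"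
        by auto
      finally show ?thesis .
    qed
    have "(\<lambda>A. real (card (A \<inter> B))) \<in> borel_measurable ?V"
    proof (rule borel_measurable_LIMSEQ_real[OF _ s_meas])
      fix A assume "A \<in> space ?V"
      then have A: "loc_fin A" by (simp add: spV)
      have "\<forall>\<^sub>F m in sequentially. s m A = real (card (A \<inter> B))"
        using eventually_inj_on_cell_index[OF loc_finD[OF A B(2)]]
        by (rule eventually_mono) (simp add: s_card[OF A] card_image)
      then show "(\<lambda>m. s m A) \<longlonglongrightarrow> real (card (A \<inter> B))"
        by (rule tendsto_eventually)
    qed
    then have "{A \<in> space ?V. real (card (A \<inter> B)) = real m} \<in> sets ?V" for m
      by measurable
    then show ?thesis
      by (subst measurable_count_space_eq2_countable) (auto simp: vimage_def Int_def conj_commute)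
  qed
  have "sets configs = sigma_sets (Collect loc_fin)
      {{A. loc_fin A \<and> card (A \<inter> B) = m} | B m. B \<in> sets borel \<and> bounded (B :: (real^'n) set)}"
    unfolding configs_def by (rule sets_measure_of) auto
  also have "\<dots> \<subseteq> sigma_sets (Collect loc_fin) void_events"
  proof (rule sigma_sets_mono, clarify)
    fix B :: "(real^'n) set" and m assume B: "B \<in> sets borel" "bounded B"
    have "(\<lambda>A. card (A \<inter> B)) -` {m} \<inter> space ?V \<in> sets ?V"
      by (rule measurable_sets[OF meas[OF B]]) simp
    then show "{A. loc_fin A \<and> card (A \<inter> B) = m} \<in> sigma_sets (Collect loc_fin) void_events"
      unfolding stV spV by (simp add: vimage_def Int_def conj_commute)
  qed
  finally show "sets (configs :: (real^'n) set measure) \<subseteq> sigma_sets (Collect loc_fin) void_events" .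
  have "void_events \<subseteq> sets (configs :: (real^'n) set measure)"
  proof
    fix E :: "(real^'n) set set" assume "E \<in> void_events"
    then obtain B where B: "E = {A. loc_fin A \<and> A \<inter> B = {}}" "B \<in> sets borel" "bounded B"
      unfolding void_events_def by auto
    have "E = (\<lambda>A. card (A \<inter> B)) -` {0} \<inter> space configs"
      using loc_finD[OF _ B(3)] unfolding B(1) by (auto simp: space_configs card_eq_0_iff)
    then show "E \<in> sets configs"
      using measurable_sets[OF card_Int_measurable[OF B(2,3)], of "{0}"] by simp
  qed
  then show "sigma_sets (Collect loc_fin) void_events \<subseteq> sets (configs :: (real^'n) set measure)"
    using sets.sigma_sets_subset[of void_events configs] by (simp add: space_configs)
qed

subsection \<open>Hop counts\<close>

text \<open>The index counts intermediate points, so \<open>near\<close> at \<open>k\<close> means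
  \<open>k + 1\<close> hops. Peeling off the first hop leaves one quantifier over points of
  \<open>A\<close> per stage, which suits induction for both locality and measurability.\<close>

fun near :: "(real^'n) set \<Rightarrow> (real^'n) set \<Rightarrow> real \<Rightarrow> nat \<Rightarrow> real^'n \<Rightarrow> bool" where
  "near A S r 0 x \<longleftrightarrow> (\<exists>y\<in>S. norm (x - r *\<^sub>R y) \<le> 1)"
| "near A S r (Suc k) x \<longleftrightarrow> (\<exists>p\<in>A. norm (x - p) \<le> 1 \<and> near A S r k p)"

lemma connectable_1: "connectable A (Suc 0) x y \<longleftrightarrow> norm (x - y) \<le> 1"
  unfolding connectable_def
  by (auto intro: exI[of _ "\<lambda>j. if j = 0 then x else y"])

lemma connectable_Suc_Suc:
  "connectable A (Suc (Suc k)) x y \<longleftrightarrow> (\<exists>p\<in>A. norm (x - p) \<le> 1 \<and> connectable A (Suc k) p y)"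
proof
  assume "connectable A (Suc (Suc k)) x y"
  then obtain p where p: "p 0 = x" "p (Suc (Suc k)) = y" "\<And>j. 1 \<le> j \<Longrightarrow> j < Suc (Suc k) \<Longrightarrow> p j \<in> A"
    "\<And>j. j < Suc (Suc k) \<Longrightarrow> norm (p j - p (Suc j)) \<le> 1"
    unfolding connectable_def by auto
  have "connectable A (Suc k) (p 1) y"
    unfolding connectable_def using p by (intro exI[of _ "\<lambda>j. p (Suc j)"]) auto
  then show "\<exists>p\<in>A. norm (x - p) \<le> 1 \<and> connectable A (Suc k) p y"
    using p(3)[of 1] p(4)[of 0] p(1) by auto
next
  assume "\<exists>p\<in>A. norm (x - p) \<le> 1 \<and> connectable A (Suc k) p y"
  then obtain q p where p: "q \<in> A" "norm (x - q) \<le> 1"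
    "p 0 = q" "p (Suc k) = y" "\<And>j. 1 \<le> j \<Longrightarrow> j < Suc k \<Longrightarrow> p j \<in> A"
    "\<And>j. j < Suc k \<Longrightarrow> norm (p j - p (Suc j)) \<le> 1"
    unfolding connectable_def by auto
  then have "p j \<in> A" if "j < Suc k" for j
    using that by (cases j) auto
  then show "connectable A (Suc (Suc k)) x y"
    unfolding connectable_def using p
    by (intro exI[of _ "case_nat x p"]) (auto split: nat.splits)
qed

lemma near_iff_connectable:
  "near A S r k x \<longleftrightarrow> (\<exists>y\<in>(\<lambda>z. r *\<^sub>R z) ` S. connectable A (Suc k) x y)"
  by (induction k arbitrary: x) (auto simp: connectable_1 connectable_Suc_Suc)

lemma hops_le_iff: "hops A S r x \<le> enat k \<longleftrightarrow> (\<exists>j<k. near A S r j x)"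
proof -
  define P where "P j \<longleftrightarrow> 1 \<le> j \<and> (\<exists>y\<in>(\<lambda>z. r *\<^sub>R z) ` S. connectable A j x y)" for j
  have "hops A S r x = (if \<exists>j. P j then enat (LEAST j. P j) else \<infinity>)"
    unfolding hops_def P_def Let_def by simp
  then have "hops A S r x \<le> enat k \<longleftrightarrow> (\<exists>j\<le>k. P j)"
  proof (cases "\<exists>j. P j")
    case True
    then show ?thesis
      using \<open>hops A S r x = _\<close> LeastI_ex[OF True] by (auto intro: order_trans[OF Least_le])
  qed simp
  also have "\<dots> \<longleftrightarrow> (\<exists>j<k. P (Suc j))"
  proof safe
    fix j assume "j \<le> k" "P j"
    then show "\<exists>j<k. P (Suc j)"
      by (intro exI[of _ "j - 1"]) (auto simp: P_def)
  next
    fix j assume "j < k" "P (Suc j)"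
    then show "\<exists>j\<le>k. P j"
      by (intro exI[of _ "Suc j"]) auto
  qed
  also have "\<dots> \<longleftrightarrow> (\<exists>j<k. near A S r j x)"
    unfolding near_iff_connectable P_def by simp
  finally show ?thesis .
qed

lemma near_local:
  assumes "\<And>p. norm (x - p) \<le> real k \<Longrightarrow> p \<in> B"
  shows "near (A \<inter> B) S r k x \<longleftrightarrow> near A S r k x"
  using assms
proof (induction k arbitrary: x)
  case (Suc k)
  have "near (A \<inter> B) S r k p \<longleftrightarrow> near A S r k p" "p \<in> B" if "norm (x - p) \<le> 1" for p
  proof -
    show "near (A \<inter> B) S r k p \<longleftrightarrow> near A S r k p"
    proof (rule Suc.IH)
      fix q assume "norm (p - q) \<le> real k"
      then have "norm (x - q) \<le> 1 + real k"
        using that norm_triangle_ineq[of "x - p" "p - q"] by simp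
      then show "q \<in> B" using Suc.prems by simp
    qed
    show "p \<in> B" using that by (intro Suc.prems) simp
  qed
  then show ?case by auto
qed simp

text \<open>The targets are the points of r S, so a shift of \<open>S\<close> by \<open>v\<close>
  has to be matched by a shift of \<open>A\<close> by \<open>r *\<^sub>R v\<close>. This mismatch of
  scales reappears in every later translation argument.\<close>

lemma near_translate:
  assumes "r \<noteq> 0"
  shows "near ((+) (r *\<^sub>R v) ` A) ((+) v ` S) r k (r *\<^sub>R v + x) \<longleftrightarrow> near A S r k x"
  by (induction k arbitrary: x) (simp_all add: scaleR_add_right)

section \<open>Hop counts in a region: measurability, locality, translation\<close>

definition near_count :: "nat \<Rightarrow> real \<Rightarrow> (real^'n) set \<Rightarrow> (real^'n) set \<Rightarrow> (real^'n) set \<Rightarrow> nat" where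
  "near_count k r B A S = card {x \<in> A \<inter> B. \<exists>j<k. near A S r j x}"

lemma hop_count_eq: "hop_count A S k r s = near_count k r (cube s) A S"
  by (simp add: hop_count_def near_count_def hops_le_iff)

text \<open>Joint measurability with the starting point is what makes the induction close: each
  stage evaluates the previous one at a random point \<open>p\<close> of \<open>A\<close>, so
  \<open>p\<close> is adjoined as a further coordinate and then removed by
  \<open>exists_point_measurable\<close>.\<close>

lemma near_measurable:
  "{(x, A, S). near A S r k x} \<inter> space (borel \<Otimes>\<^sub>M (configs \<Otimes>\<^sub>M configs))
     \<in> sets ((borel :: (real^'n) measure) \<Otimes>\<^sub>M (configs \<Otimes>\<^sub>M configs))"
proof (induction k)
  let ?N = "(borel :: (real^'n) measure) \<Otimes>\<^sub>M (configs \<Otimes>\<^sub>M configs)"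
  case 0
  let ?Q = "{(p, x, A, S). norm (x - r *\<^sub>R p) \<le> 1} \<inter> space (borel \<Otimes>\<^sub>M ?N)"
  have "{w \<in> space (borel \<Otimes>\<^sub>M ?N). norm (fst (snd w) - r *\<^sub>R fst w) \<le> 1} \<in> sets (borel \<Otimes>\<^sub>M ?N)"
    by measurable
  also have "{w \<in> space (borel \<Otimes>\<^sub>M ?N). norm (fst (snd w) - r *\<^sub>R fst w) \<le> 1} = ?Q"
    by auto
  finally have "{\<omega> \<in> space ?N. \<exists>p \<in> snd (snd \<omega>). (p, \<omega>) \<in> ?Q} \<in> sets ?N"
    by (rule exists_point_measurable[rotated]) measurable
  also have "{\<omega> \<in> space ?N. \<exists>p \<in> snd (snd \<omega>). (p, \<omega>) \<in> ?Q}
      = {(x, A, S). near A S r 0 x} \<inter> space ?N"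
    by (auto simp: space_pair_measure)
  finally show ?case .
next
  let ?N = "(borel :: (real^'n) measure) \<Otimes>\<^sub>M (configs \<Otimes>\<^sub>M configs)"
  case (Suc k)
  let ?Q = "{(p, x, A, S). norm (x - p) \<le> 1 \<and> near A S r k p} \<inter> space (borel \<Otimes>\<^sub>M ?N)"
  have "{w \<in> space (borel \<Otimes>\<^sub>M ?N). norm (fst (snd w) - fst w) \<le> 1} \<in> sets (borel \<Otimes>\<^sub>M ?N)"
    by measurable
  moreover have "(\<lambda>w. (fst w, snd (snd w))) -` ({(x, A, S). near A S r k x} \<inter> space ?N)
      \<inter> space (borel \<Otimes>\<^sub>M ?N) \<in> sets (borel \<Otimes>\<^sub>M ?N)"
    by (rule measurable_sets[OF _ Suc.IH]) measurable
  ultimately have "{w \<in> space (borel \<Otimes>\<^sub>M ?N). norm (fst (snd w) - fst w) \<le> 1} \<inter>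
      ((\<lambda>w. (fst w, snd (snd w))) -` ({(x, A, S). near A S r k x} \<inter> space ?N)
      \<inter> space (borel \<Otimes>\<^sub>M ?N)) \<in> sets (borel \<Otimes>\<^sub>M ?N)"
    by (rule sets.Int)
  also have "{w \<in> space (borel \<Otimes>\<^sub>M ?N). norm (fst (snd w) - fst w) \<le> 1} \<inter>
      ((\<lambda>w. (fst w, snd (snd w))) -` ({(x, A, S). near A S r k x} \<inter> space ?N)
      \<inter> space (borel \<Otimes>\<^sub>M ?N)) = ?Q"
    by (auto simp: space_pair_measure)
  finally have "{\<omega> \<in> space ?N. \<exists>p \<in> fst (snd \<omega>). (p, \<omega>) \<in> ?Q} \<in> sets ?N"
    by (rule exists_point_measurable[rotated]) measurable
  also have "{\<omega> \<in> space ?N. \<exists>p \<in> fst (snd \<omega>). (p, \<omega>) \<in> ?Q}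
      = {(x, A, S). near A S r (Suc k) x} \<inter> space ?N"
    by (auto simp: space_pair_measure)
  finally show ?case .
qed

lemma near_count_measurable:
  assumes B: "B \<in> sets borel" "bounded (B :: (real^'n) set)"
  shows "(\<lambda>(A, S). real (near_count k r B A S)) \<in> borel_measurable (configs \<Otimes>\<^sub>M configs)"
proof -
  let ?N = "(configs :: (real^'n) set measure) \<Otimes>\<^sub>M (configs :: (real^'n) set measure)"
  let ?Q = "(\<Union>j<k. {(x, A, S). near A S r j x} \<inter> space ((borel :: (real^'n) measure) \<Otimes>\<^sub>M ?N))"
  have "?Q \<in> sets (borel \<Otimes>\<^sub>M ?N)"
  proof (rule sets.finite_UN[OF finite_lessThan])
    fix j show "{(x, A, S). near A S r j x} \<inter> space (borel \<Otimes>\<^sub>M ?N) \<in> sets (borel \<Otimes>\<^sub>M ?N)"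
      by (rule near_measurable)
  qed
  then have "(\<lambda>\<omega>. real (card {p \<in> fst \<omega> \<inter> B. (p, \<omega>) \<in> ?Q})) \<in> borel_measurable ?N"
    by (rule card_select_measurable[OF measurable_fst B])
  moreover have "real (card {p \<in> fst \<omega> \<inter> B. (p, \<omega>) \<in> ?Q}) = (case \<omega> of (A, S) \<Rightarrow> real (near_count k r B A S))"
    if "\<omega> \<in> space ?N" for \<omega>
  proof -
    obtain A S where w: "\<omega> = (A, S)" by (cases \<omega>)
    have "{p \<in> fst \<omega> \<inter> B. (p, \<omega>) \<in> ?Q} = {x \<in> A \<inter> B. \<exists>j<k. near A S r j x}"
      using that unfolding w by (auto simp: space_pair_measure)
    then show ?thesis
      unfolding w near_count_def by simp
  qed
  ultimately show ?thesis
    by (simp cong: measurable_cong)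
qed

lemma near_count_local:
  assumes "\<And>x p. x \<in> B \<Longrightarrow> norm (x - p) \<le> real k \<Longrightarrow> p \<in> C"
  shows "near_count k r B (A \<inter> C) S = near_count k r B A S"
proof -
  have "near (A \<inter> C) S r j x \<longleftrightarrow> near A S r j x" if "x \<in> B" "j < k" for x j
  proof (rule near_local)
    fix p assume "norm (x - p) \<le> real j"
    then show "p \<in> C" using that by (intro assms[of x]) auto
  qed
  moreover have "x \<in> C" if "x \<in> B" for x
    using that by (intro assms[of x]) auto
  ultimately have "{x \<in> A \<inter> C \<inter> B. \<exists>j<k. near (A \<inter> C) S r j x} = {x \<in> A \<inter> B. \<exists>j<k. near A S r j x}"
    by (intro Collect_cong) auto
  then show ?thesis
    unfolding near_count_def by simp
qed

lemma near_count_translate: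
  assumes "r \<noteq> 0"
  shows "near_count k r B ((+) (r *\<^sub>R v) ` A) ((+) v ` S) = near_count k r {x :: real^'n. r *\<^sub>R v + x \<in> B} A S"
proof -
  have "{x \<in> g ` A \<inter> B. P x} = g ` {x \<in> A \<inter> {x. g x \<in> B}. P (g x)}" for P and g :: "real^'n \<Rightarrow> real^'n"
    by auto
  then have "{x \<in> (+) (r *\<^sub>R v) ` A \<inter> B. \<exists>j<k. near ((+) (r *\<^sub>R v) ` A) ((+) v ` S) r j x}
      = (+) (r *\<^sub>R v) ` {x \<in> A \<inter> {x. r *\<^sub>R v + x \<in> B}. \<exists>j<k. near A S r j x}"
    by (simp only: near_translate[OF assms])
  then show ?thesis
    unfolding near_count_def by (simp add: card_image)
qed

lemma near_count_mono:
  assumes "loc_fin A" "bounded C" "A \<inter> B \<subseteq> C"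
  shows "near_count k r B A S \<le> near_count k r C A S"
proof -
  have "finite {x \<in> A \<inter> C. \<exists>j<k. near A S r j x}"
    using loc_finD[OF assms(1,2)] by (rule rev_finite_subset) blast
  then show ?thesis
    unfolding near_count_def by (rule card_mono) (use assms(3) in blast)
qed

lemma near_count_le_card:
  assumes "loc_fin A" "bounded B"
  shows "near_count k r B A S \<le> card (A \<inter> B)"
  unfolding near_count_def
  using assms by (intro card_mono loc_finD) auto

subsection \<open>Boxes in the integer lattice\<close>

text \<open>Half-open with 2n points per side: this matches the number of cells of side 1/2 along a
  cube of side n, and doubling n multiplies the cardinality by exactly 2^d.\<close>

definition zbox :: "nat \<Rightarrow> (int^'n) set" where
  "zbox n = {z. \<forall>i. - int n \<le> z $ i \<and> z $ i < int n}"

lemma zbox_bij: "bij_betw vec_lambda (UNIV \<rightarrow>\<^sub>E {- int n..<int n}) (zbox n :: (int^'n) set)"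
proof (rule bij_betwI[where g = "\<lambda>z i. z $ i"])
qed (auto simp: zbox_def PiE_def Pi_def)

lemma finite_zbox [simp]: "finite (zbox n)"
  using bij_betw_finite[OF zbox_bij[of n]] by (auto intro: finite_PiE)

lemma card_zbox: "card (zbox n :: (int^'n) set) = (2 * n) ^ CARD('n)"
  using bij_betw_same_card[OF zbox_bij[where ?'n = 'n, of n]]
  by (simp add: card_PiE nat_mult_distrib)

lemma zbox_mono: "m \<le> n \<Longrightarrow> zbox m \<subseteq> zbox n"
  unfolding zbox_def by (auto intro: order_trans[rotated] less_le_trans)

lemma zbox_add:
  assumes "\<And>i. \<bar>z $ i\<bar> \<le> int L" "w \<in> zbox n"
  shows "z + w \<in> zbox (n + L)"
  unfolding zbox_def
proof (intro CollectI allI)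
  fix i
  show "- int (n + L) \<le> (z + w) $ i \<and> (z + w) $ i < int (n + L)"
    using assms(1)[of i] assms(2) unfolding zbox_def by (auto dest: spec[of _ i])
qed

lemma zbox_abs: "z \<in> zbox m \<Longrightarrow> \<bar>z $ i\<bar> \<le> int m"
  unfolding zbox_def by (auto dest: spec[of _ i])

text \<open>The lattice points that a translation of \<open>zbox n\<close> by at most \<open>L\<close> can affect.\<close>

definition shell :: "nat \<Rightarrow> nat \<Rightarrow> (int^'n) set" where
  "shell L n = zbox (n + L) - zbox (n - L)"

lemma finite_shell [simp]: "finite (shell L n)"
  unfolding shell_def by simp

lemma zbox_scaled_tendsto:
  "(\<lambda>n. real (card (zbox (n + L) :: (int^'n) set)) / real (card (zbox n :: (int^'n) set))) \<longlonglongrightarrow> 1"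
proof -
  have "(\<lambda>n. (real (n + L) / real n) ^ CARD('n)) \<longlonglongrightarrow> 1 ^ CARD('n)"
    by (intro tendsto_power) real_asymp
  moreover have "(real (n + L) / real n) ^ CARD('n)
      = real (card (zbox (n + L) :: (int^'n) set)) / real (card (zbox n :: (int^'n) set))" for n
  proof -
    have "real (n + L) / real n = real (2 * (n + L)) / real (2 * n)"
      unfolding of_nat_mult by (subst mult_divide_mult_cancel_left) simp_all
    then show ?thesis
      by (simp only: card_zbox of_nat_power flip: power_divide)
  qed
  ultimately show ?thesis by simp
qed

lemma shell_tendsto_0:
  "(\<lambda>n. real (card (shell L n :: (int^'n) set)) / real (card (zbox n :: (int^'n) set))) \<longlonglongrightarrow> 0"
\<comment> \<open>After the offset the truncated subtraction \<open>n - L\<close> in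
  \<open>shell\<close> becomes exact.\<close>
proof (rule LIMSEQ_offset[where k = L])
  let ?c = "\<lambda>n. real (card (zbox n :: (int^'n) set))"
  have 1: "(\<lambda>n. ?c (n + L + L) / ?c (n + L)) \<longlonglongrightarrow> 1"
    by (rule LIMSEQ_ignore_initial_segment[OF zbox_scaled_tendsto])
  have "(\<lambda>n. inverse (?c (n + L) / ?c n)) \<longlonglongrightarrow> inverse 1"
    by (intro tendsto_inverse zbox_scaled_tendsto) simp
  then have "(\<lambda>n. ?c n / ?c (n + L)) \<longlonglongrightarrow> 1" by simp
  from tendsto_diff[OF 1 this]
  have "(\<lambda>n. (?c (n + L + L) - ?c n) / ?c (n + L)) \<longlonglongrightarrow> 0"
    by (simp add: diff_divide_distrib)
  moreover have "real (card (shell L (n + L) :: (int^'n) set)) = ?c (n + L + L) - ?c n" for n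
    unfolding shell_def by (simp add: card_Diff_subset zbox_mono card_mono of_nat_diff)
  ultimately show "(\<lambda>n. real (card (shell L (n + L) :: (int^'n) set)) / ?c (n + L)) \<longlonglongrightarrow> 0"
    by simp
qed

text \<open>Terms common to the box and its translate cancel; what is left is indexed by their
  symmetric difference, which lies in the shell.\<close>

lemma sum_zbox_translate:
  fixes f :: "int^'n \<Rightarrow> real"
  assumes z: "\<And>i. \<bar>z $ i\<bar> \<le> int L" and f: "\<And>w. \<bar>f w\<bar> \<le> K"
  shows "\<bar>(\<Sum>w\<in>zbox n. f (z + w)) - (\<Sum>w\<in>zbox n. f w)\<bar> \<le> K * real (card (shell L n :: (int^'n) set))"
proof -
  let ?A = "(+) z ` zbox n" and ?B = "zbox n"
  have "(\<Sum>w\<in>zbox n. f (z + w)) = sum f ?A"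
    by (simp add: sum.reindex)
  moreover have "sum f ?A = sum f (?A - ?B) + sum f (?A \<inter> ?B)" "sum f ?B = sum f (?B - ?A) + sum f (?A \<inter> ?B)"
    by (subst sum.union_disjoint[symmetric]; auto intro!: sum.cong)+
  ultimately have "\<bar>(\<Sum>w\<in>zbox n. f (z + w)) - (\<Sum>w\<in>zbox n. f w)\<bar> = \<bar>sum f (?A - ?B) - sum f (?B - ?A)\<bar>"
    by simp
  also have "\<dots> \<le> (\<Sum>w\<in>?A - ?B. \<bar>f w\<bar>) + (\<Sum>w\<in>?B - ?A. \<bar>f w\<bar>)"
    by (rule order_trans[OF abs_triangle_ineq4]) (intro add_mono sum_abs)
  also have "\<dots> = (\<Sum>w\<in>(?A - ?B) \<union> (?B - ?A). \<bar>f w\<bar>)"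
    by (subst sum.union_disjoint) auto
  also have "\<dots> \<le> (\<Sum>w\<in>shell L n. \<bar>f w\<bar>)"
  proof (rule sum_mono2)
    have "w \<in> ?A" if "w \<in> zbox (n - L)" for w
    proof (cases "L \<le> n")
      case True
      then have "- z + w \<in> zbox n"
        using zbox_add[of "- z" L w "n - L"] z that by simp
      then show ?thesis by (auto intro: image_eqI[of _ _ "- z + w"])
    next
      case False
      then show ?thesis using that by (auto simp: zbox_def)
    qed
    moreover have "?A \<subseteq> zbox (n + L)" using zbox_add[OF z] by auto
    ultimately show "(?A - ?B) \<union> (?B - ?A) \<subseteq> shell L n"
      using zbox_mono[of n "n + L"] zbox_mono[of "n - L" n] unfolding shell_def by auto
  qed auto
  also have "\<dots> \<le> K * real (card (shell L n :: (int^'n) set))"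
    using sum_bounded_above[of "shell L n" "\<lambda>w. \<bar>f w\<bar>" K] f by (simp add: mult.commute)
  finally show ?thesis .
qed

text \<open>Greedy choice of a largest box, discarding every box that meets it. Only the centres
  have to be covered, not the discarded boxes themselves, so doubling the radius suffices instead of
  tripling it.\<close>

lemma vitali_zbox:
  fixes D :: "(int^'n) set" and \<rho> :: "int^'n \<Rightarrow> nat"
  assumes "finite D" "\<And>z. z \<in> D \<Longrightarrow> 0 < \<rho> z"
  shows "\<exists>D'\<subseteq>D. disjoint_family_on (\<lambda>z. (+) z ` zbox (\<rho> z)) D' \<and>
    D \<subseteq> (\<Union>z\<in>D'. (+) z ` zbox (2 * \<rho> z))"
  using assms
proof (induction D rule: finite_psubset_induct)
  case (psubset D)
  show ?case
  proof (cases "D = {}")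
    case False
    have "Max (\<rho> ` D) \<in> \<rho> ` D"
      using psubset.hyps False by (intro Max_in) auto
    then obtain z0 where z0: "z0 \<in> D" "\<rho> z0 = Max (\<rho> ` D)"
      by auto
    have max: "\<rho> z \<le> \<rho> z0" if "z \<in> D" for z
      unfolding z0(2) using psubset.hyps that by simp
    define D1 where "D1 = {z \<in> D. (+) z ` zbox (\<rho> z) \<inter> (+) z0 ` zbox (\<rho> z0) = {}}"
    have self: "0 \<in> zbox m" if "0 < m" for m
      using that by (simp add: zbox_def)
    have "z0 \<notin> D1"
      using self[OF psubset.prems[OF z0(1)]] by (auto simp: D1_def)
    then have "D1 \<subset> D"
      using z0(1) by (auto simp: D1_def)
    then obtain D' where D': "D' \<subseteq> D1" "disjoint_family_on (\<lambda>z. (+) z ` zbox (\<rho> z)) D'"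
      "D1 \<subseteq> (\<Union>z\<in>D'. (+) z ` zbox (2 * \<rho> z))"
      using psubset.IH[of D1] psubset.prems by blast
    have "disjoint_family_on (\<lambda>z. (+) z ` zbox (\<rho> z)) (insert z0 D')"
      using D'(1,2) unfolding disjoint_family_on_def D1_def by (auto; blast)
    moreover have "z \<in> (+) z0 ` zbox (2 * \<rho> z0)" if "z \<in> D" "z \<notin> D1" for z
    proof -
      have "(+) z ` zbox (\<rho> z) \<inter> (+) z0 ` zbox (\<rho> z0) \<noteq> {}"
        using that unfolding D1_def by blast
      then obtain a b where ab: "z + a = z0 + b" "a \<in> zbox (\<rho> z)" "b \<in> zbox (\<rho> z0)"
        by blast
      have "b - a \<in> zbox (2 * \<rho> z0)"
        unfolding zbox_def
      proof (intro CollectI allI)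
        fix i
        have "- int (\<rho> z) \<le> a $ i" "a $ i < int (\<rho> z)" "- int (\<rho> z0) \<le> b $ i" "b $ i < int (\<rho> z0)"
          using ab(2,3) by (auto simp: zbox_def)
        then show "- int (2 * \<rho> z0) \<le> (b - a) $ i \<and> (b - a) $ i < int (2 * \<rho> z0)"
          using max[OF that(1)] by auto
      qed
      moreover have "z = z0 + (b - a)"
        using ab(1) by (simp add: algebra_simps)
      ultimately show ?thesis by blast
    qed
    ultimately have "D \<subseteq> (\<Union>z\<in>insert z0 D'. (+) z ` zbox (2 * \<rho> z))"
      using D'(3) by blast
    moreover have "insert z0 D' \<subseteq> D"
      using D'(1) \<open>D1 \<subset> D\<close> z0(1) by blast
    ultimately show ?thesis
      using \<open>disjoint_family_on _ (insert z0 D')\<close> by blast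
  qed (simp add: disjoint_family_on_def)
qed

text \<open>Weak-type inequality on the lattice. The selected boxes are disjoint and each carries
  mass at least \<open>e\<close> times its size, while their doubles, 2^d times as large, cover
  \<open>D\<close>. Radii up to \<open>L\<close> around centres in \<open>zbox R\<close> stay inside
  \<open>zbox (R + L)\<close>.\<close>

lemma zbox_maximal:
  fixes h :: "int^'n \<Rightarrow> real"
  assumes h: "\<And>w. 0 \<le> h w" and D: "D \<subseteq> zbox R" and e: "0 < e"
    and \<rho>: "\<And>z. z \<in> D \<Longrightarrow> 0 < \<rho> z \<and> \<rho> z \<le> L"
    and big: "\<And>z. z \<in> D \<Longrightarrow> e * real (card (zbox (\<rho> z) :: (int^'n) set)) \<le> (\<Sum>w\<in>zbox (\<rho> z). h (z + w))"
  shows "e * real (card D) \<le> 2 ^ CARD('n) * (\<Sum>w\<in>zbox (R + L). h w)"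
proof -
  have "finite D" using D by (rule finite_subset) simp
  from vitali_zbox[OF this, of \<rho>] \<rho> obtain D' where D': "D' \<subseteq> D"
    "disjoint_family_on (\<lambda>z. (+) z ` zbox (\<rho> z)) D'" "D \<subseteq> (\<Union>z\<in>D'. (+) z ` zbox (2 * \<rho> z))"
    by blast
  have fin': "finite D'" using \<open>finite D\<close> D'(1) by (rule rev_finite_subset)
  have "card D \<le> (\<Sum>z\<in>D'. card ((+) z ` zbox (2 * \<rho> z) :: (int^'n) set))"
    using card_mono[OF _ D'(3)] card_UN_le[OF fin', of "\<lambda>z. (+) z ` zbox (2 * \<rho> z)"] fin'
    by (auto intro: order_trans)
  also have "\<dots> = (\<Sum>z\<in>D'. 2 ^ CARD('n) * card (zbox (\<rho> z) :: (int^'n) set))"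
  proof (rule sum.cong[OF refl])
    fix z
    show "card ((+) z ` zbox (2 * \<rho> z) :: (int^'n) set) = 2 ^ CARD('n) * card (zbox (\<rho> z) :: (int^'n) set)"
      by (subst card_image, simp) (simp only: card_zbox power_mult_distrib)
  qed
  finally have "real (card D) \<le> real (\<Sum>z\<in>D'. 2 ^ CARD('n) * card (zbox (\<rho> z) :: (int^'n) set))"
    by (rule of_nat_mono)
  then have "e * real (card D) \<le> e * real (\<Sum>z\<in>D'. 2 ^ CARD('n) * card (zbox (\<rho> z) :: (int^'n) set))"
    using e by (intro mult_left_mono) auto
  also have "\<dots> = 2 ^ CARD('n) * (\<Sum>z\<in>D'. e * real (card (zbox (\<rho> z) :: (int^'n) set)))"
    by (simp add: sum_distrib_left mult_ac)
  also have "(\<Sum>z\<in>D'. e * real (card (zbox (\<rho> z) :: (int^'n) set))) \<le> (\<Sum>z\<in>D'. \<Sum>w\<in>zbox (\<rho> z). h (z + w))"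
    using big D'(1) by (intro sum_mono) auto
  also have "\<dots> = (\<Sum>z\<in>D'. sum h ((+) z ` zbox (\<rho> z)))"
    by (simp add: sum.reindex)
  also have "\<dots> = sum h (\<Union>z\<in>D'. (+) z ` zbox (\<rho> z))"
    using D'(2) fin' by (subst sum.UNION_disjoint) (auto simp: disjoint_family_on_def)
  also have "\<dots> \<le> sum h (zbox (R + L))"
  proof (rule sum_mono2)
    have "z + w \<in> zbox (R + L)" if "z \<in> D'" "w \<in> zbox (\<rho> z)" for z w
    proof -
      have "z \<in> zbox R" "w \<in> zbox L"
        using that D'(1) D \<rho> zbox_mono[of "\<rho> z" L] by blast+
      then show ?thesis
        using zbox_add[of w L z R] zbox_abs[of w L] by (simp add: add.commute)
    qed
    then show "(\<Union>z\<in>D'. (+) z ` zbox (\<rho> z)) \<subseteq> zbox (R + L)" by auto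
  qed (auto intro: h)
  finally show ?thesis by simp
qed

subsection \<open>A pointwise ergodic theorem for lattice actions\<close>

text \<open>The action is measure preserving but no ergodicity is part of the locale: the lattice
  shifts of a process that is ergodic under real translations can have non-trivial invariant
  events.\<close>

locale lattice_action = prob_space P for P :: "'a measure" +
  fixes T :: "int^'n \<Rightarrow> 'a \<Rightarrow> 'a"
  assumes T_measurable [measurable]: "\<And>z. T z \<in> measurable P P"
    and T_distr: "\<And>z. distr P P (T z) = P"
    and T_add: "\<And>z w \<omega>. \<omega> \<in> space P \<Longrightarrow> T z (T w \<omega>) = T (z + w) \<omega>"
begin

definition avg :: "nat \<Rightarrow> ('a \<Rightarrow> real) \<Rightarrow> 'a \<Rightarrow> real" where
  "avg n f \<omega> = (\<Sum>z\<in>zbox n. f (T z \<omega>)) / real (card (zbox n :: (int^'n) set))"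

lemma T_space: "\<omega> \<in> space P \<Longrightarrow> T z \<omega> \<in> space P"
  using T_measurable by (rule measurable_space)

lemma avg_measurable [measurable]:
  assumes [measurable]: "f \<in> borel_measurable P"
  shows "avg n f \<in> borel_measurable P"
  unfolding avg_def by measurable

lemma zbox_nonempty: "0 < n \<Longrightarrow> zbox n \<noteq> ({} :: (int^'n) set)"
  by (auto simp: zbox_def intro!: exI[of _ 0])

lemma card_zbox_pos: "0 < n \<Longrightarrow> 0 < real (card (zbox n :: (int^'n) set))"
  by (simp add: card_zbox)

lemma avg_abs_le:
  assumes "\<forall>\<omega>\<in>space P. \<bar>f \<omega>\<bar> \<le> K" "\<omega> \<in> space P"
  shows "\<bar>avg n f \<omega>\<bar> \<le> K"
proof -
  have K: "0 \<le> K" using assms by force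
  have "\<bar>\<Sum>z\<in>zbox n. f (T z \<omega>)\<bar> \<le> (\<Sum>z\<in>zbox n. \<bar>f (T z \<omega>)\<bar>)"
    by (rule sum_abs)
  also have "\<dots> \<le> real (card (zbox n :: (int^'n) set)) * K"
    using assms by (intro sum_bounded_above) (auto intro: T_space)
  finally show ?thesis
    using K by (cases "zbox n = ({} :: (int^'n) set)") (simp_all add: avg_def field_simps card_gt_0_iff)
qed

lemma integral_T:
  assumes "f \<in> borel_measurable P"
  shows "(\<integral>\<omega>. f (T z \<omega>) \<partial>P) = (\<integral>\<omega>. f \<omega> \<partial>P :: real)"
  using integral_distr[OF T_measurable assms, of z] T_distr[of z] by simp

lemma integrable_bounded:
  fixes f :: "'a \<Rightarrow> real"
  assumes "f \<in> borel_measurable P" "\<forall>\<omega>\<in>space P. \<bar>f \<omega>\<bar> \<le> K"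
  shows "integrable P f"
  by (rule integrable_const_bound[where B = K]) (use assms in auto)

lemma integrable_square:
  fixes f :: "'a \<Rightarrow> real"
  assumes [measurable]: "f \<in> borel_measurable P" and f: "\<forall>\<omega>\<in>space P. \<bar>f \<omega>\<bar> \<le> K"
  shows "integrable P (\<lambda>\<omega>. (f \<omega>)\<^sup>2)"
proof (rule integrable_bounded)
  show "\<forall>\<omega>\<in>space P. \<bar>(f \<omega>)\<^sup>2\<bar> \<le> K\<^sup>2"
    using power_mono[OF bspec[OF f], of _ 2] by simp
qed measurable

lemma avg_bounded: "\<forall>\<omega>\<in>space P. \<bar>f \<omega>\<bar> \<le> K \<Longrightarrow> \<forall>\<omega>\<in>space P. \<bar>avg n f \<omega>\<bar> \<le> K"
  using avg_abs_le by blast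

lemma integral_avg:
  assumes "f \<in> borel_measurable P" "\<forall>\<omega>\<in>space P. \<bar>f \<omega>\<bar> \<le> K" "0 < n"
  shows "(\<integral>\<omega>. avg n f \<omega> \<partial>P) = (\<integral>\<omega>. f \<omega> \<partial>P)"
proof -
  have "integrable P (\<lambda>\<omega>. f (T z \<omega>))" for z
    using assms by (intro integrable_bounded[where K = K]) (auto intro: T_space)
  then have "(\<integral>\<omega>. avg n f \<omega> \<partial>P) = real (card (zbox n :: (int^'n) set)) * (\<integral>\<omega>. f \<omega> \<partial>P) / real (card (zbox n :: (int^'n) set))"
    unfolding avg_def using integral_T[OF assms(1)] by simp
  then show ?thesis
    using card_zbox_pos[OF assms(3)] by (metis nonzero_mult_div_cancel_left less_irrefl)
qed

definition translation_error :: "real \<Rightarrow> nat \<Rightarrow> nat \<Rightarrow> real" where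
  "translation_error K m n = K * (real (card (shell m n :: (int^'n) set)) / real (card (zbox n :: (int^'n) set)))"

lemma translation_error_tendsto: "(\<lambda>n. translation_error K m n) \<longlonglongrightarrow> 0"
  unfolding translation_error_def using tendsto_mult[OF tendsto_const shell_tendsto_0] by fastforce

text \<open>Interchanging the sums turns the double average into a mean of averages over boxes
  shifted by elements of \<open>zbox m\<close>, each off by a shell term. Hence \<open>f\<close> may
  be replaced by any fixed average of itself in every limit; this does the work of the usual
  splitting into an invariant part and coboundaries.\<close>

lemma avg_avg:
  assumes f: "\<forall>\<omega>\<in>space P. \<bar>f \<omega>\<bar> \<le> K" and \<omega>: "\<omega> \<in> space P" and m: "0 < m"
  shows "\<bar>avg n (avg m f) \<omega> - avg n f \<omega>\<bar> \<le> translation_error K m n"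
proof -
  let ?c = "\<lambda>n. real (card (zbox n :: (int^'n) set))"
  let ?s = "\<lambda>z. \<Sum>w\<in>zbox n. f (T (z + w) \<omega>)"
  have m': "?c m \<noteq> 0" using zbox_nonempty[OF m] by simp
  have "avg n (avg m f) \<omega> = (\<Sum>w\<in>zbox n. \<Sum>z\<in>zbox m. f (T (z + w) \<omega>)) / ?c m / ?c n"
    unfolding avg_def using T_add[OF \<omega>] by (simp flip: sum_divide_distrib)
  also have "\<dots> = (\<Sum>z\<in>zbox m. ?s z) / ?c m / ?c n"
    by (subst sum.swap) simp
  finally have "avg n (avg m f) \<omega> - avg n f \<omega> = (\<Sum>z\<in>zbox m. ?s z - ?s 0) / ?c m / ?c n"
    by (simp only: sum_subtractf sum_constant avg_def add_0 diff_divide_distrib nonzero_mult_div_cancel_left[OF m'])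
  moreover have "\<bar>\<Sum>z\<in>zbox m. ?s z - ?s 0\<bar> \<le> ?c m * (K * real (card (shell m n :: (int^'n) set)))"
  proof -
    have "\<bar>?s z - ?s 0\<bar> \<le> K * real (card (shell m n :: (int^'n) set))" if "z \<in> zbox m" for z
      using sum_zbox_translate[of z m "\<lambda>w. f (T w \<omega>)" K n] zbox_abs[OF that] f T_space[OF \<omega>] by simp
    then show ?thesis
      by (intro order_trans[OF sum_abs] sum_bounded_above)
  qed
  ultimately have "\<bar>avg n (avg m f) \<omega> - avg n f \<omega>\<bar>
      \<le> ?c m * (K * real (card (shell m n :: (int^'n) set))) / ?c m / ?c n"
    by (simp only: abs_divide abs_of_nat) (intro divide_right_mono, simp_all)
  then show ?thesis
    unfolding translation_error_def using nonzero_mult_div_cancel_left[OF m'] by simp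
qed

lemma avg_add: "avg n (\<lambda>\<omega>. f \<omega> + g \<omega>) \<omega> = avg n f \<omega> + avg n g \<omega>"
  by (simp add: avg_def sum.distrib add_divide_distrib)

lemma avg_cmult: "avg n (\<lambda>\<omega>. c * f \<omega>) \<omega> = c * avg n f \<omega>"
  by (simp add: avg_def flip: sum_distrib_left)

text \<open>Jensen's inequality for the uniform weights on the box, followed by invariance of the
  measure.\<close>

lemma integral_avg_square_le:
  assumes [measurable]: "f \<in> borel_measurable P" and f: "\<forall>\<omega>\<in>space P. \<bar>f \<omega>\<bar> \<le> K"
    and n: "0 < n"
  shows "(\<integral>\<omega>. (avg n f \<omega>)\<^sup>2 \<partial>P) \<le> (\<integral>\<omega>. (f \<omega>)\<^sup>2 \<partial>P)"
proof -
  let ?c = "real (card (zbox n :: (int^'n) set))"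
  have sq: "\<forall>\<omega>\<in>space P. \<bar>(f \<omega>)\<^sup>2\<bar> \<le> K\<^sup>2"
    using power_mono[OF bspec[OF f], of _ 2] by simp
  have "(avg n f \<omega>)\<^sup>2 \<le> avg n (\<lambda>\<omega>. (f \<omega>)\<^sup>2) \<omega>" for \<omega>
  proof -
    have "(\<Sum>z\<in>zbox n. f (T z \<omega>) * 1)\<^sup>2 \<le> (\<Sum>z\<in>zbox n. (f (T z \<omega>))\<^sup>2) * (\<Sum>z\<in>(zbox n :: (int^'n) set). 1\<^sup>2)"
      by (rule Cauchy_Schwarz_ineq_sum)
    then have "(\<Sum>z\<in>zbox n. f (T z \<omega>))\<^sup>2 \<le> (\<Sum>z\<in>zbox n. (f (T z \<omega>))\<^sup>2) * ?c"
      by simp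
    then have "(\<Sum>z\<in>zbox n. f (T z \<omega>))\<^sup>2 / ?c\<^sup>2 \<le> (\<Sum>z\<in>zbox n. (f (T z \<omega>))\<^sup>2) * ?c / ?c\<^sup>2"
      by (rule divide_right_mono) simp
    also have "(\<Sum>z\<in>zbox n. (f (T z \<omega>))\<^sup>2) * ?c / ?c\<^sup>2 = avg n (\<lambda>\<omega>. (f \<omega>)\<^sup>2) \<omega>"
      using zbox_nonempty[OF n] unfolding avg_def power2_eq_square[of ?c] by (intro mult_divide_mult_cancel_right) simp
    finally show ?thesis
      by (simp add: avg_def power_divide)
  qed
  then have "(\<integral>\<omega>. (avg n f \<omega>)\<^sup>2 \<partial>P) \<le> (\<integral>\<omega>. avg n (\<lambda>\<omega>. (f \<omega>)\<^sup>2) \<omega> \<partial>P)"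
    by (intro integral_mono integrable_square[OF _ avg_bounded[OF f]] integrable_bounded[OF _ avg_bounded[OF sq]]) auto
  also have "\<dots> = (\<integral>\<omega>. (f \<omega>)\<^sup>2 \<partial>P)"
    using sq by (intro integral_avg[OF _ _ n]) auto
  finally show ?thesis .
qed

text \<open>Replacing \<open>f\<close> by a combination \<open>g\<close> of its translates changes the averages \<open>avg N f\<close> by a
  vanishing amount, so \<open>\<integral>(avg N f)\<^sup>2\<close> is asymptotically at most \<open>\<integral>g\<^sup>2\<close>.\<close>

lemma integral_avg_square_le_comb:
  assumes [measurable]: "f \<in> borel_measurable P" and f: "\<forall>\<omega>\<in>space P. \<bar>f \<omega>\<bar> \<le> K"
    and m: "0 < m" "0 < n" and N: "0 < N"
  shows "(\<integral>\<omega>. (avg N f \<omega>)\<^sup>2 \<partial>P) \<le> (\<integral>\<omega>. ((avg m f \<omega> + avg n f \<omega>) / 2)\<^sup>2 \<partial>P)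
    + 2 * K * (translation_error K m N + translation_error K n N)"
proof -
  let ?g = "\<lambda>\<omega>. (avg m f \<omega> + avg n f \<omega>) / 2"
  have g: "\<forall>\<omega>\<in>space P. \<bar>?g \<omega>\<bar> \<le> K"
  proof
    fix \<omega> assume "\<omega> \<in> space P"
    then show "\<bar>?g \<omega>\<bar> \<le> K"
      using avg_abs_le[OF f, of \<omega> m] avg_abs_le[OF f, of \<omega> n] by (simp add: abs_le_iff)
  qed
  have pt: "(avg N f \<omega>)\<^sup>2 \<le> (avg N ?g \<omega>)\<^sup>2 + 2 * K * (translation_error K m N + translation_error K n N)" if "\<omega> \<in> space P" for \<omega>
  proof -
    have "avg N ?g \<omega> = (avg N (avg m f) \<omega> + avg N (avg n f) \<omega>) / 2"
      using avg_cmult[of N "1/2" "\<lambda>\<omega>. avg m f \<omega> + avg n f \<omega>"] by (simp add: avg_add)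
    then have d: "\<bar>avg N f \<omega> - avg N ?g \<omega>\<bar> \<le> translation_error K m N + translation_error K n N"
      using avg_avg[OF f that m(1), of N] avg_avg[OF f that m(2), of N] by (simp add: abs_if split: if_splits)
    have "\<bar>(avg N f \<omega>)\<^sup>2 - (avg N ?g \<omega>)\<^sup>2\<bar> = \<bar>avg N f \<omega> + avg N ?g \<omega>\<bar> * \<bar>avg N f \<omega> - avg N ?g \<omega>\<bar>"
      by (simp add: power2_eq_square algebra_simps flip: abs_mult)
    also have "\<dots> \<le> (2 * K) * (translation_error K m N + translation_error K n N)"
      using avg_abs_le[OF f that, of N] avg_abs_le[OF g that, of N] d
      by (intro mult_mono) auto
    finally show ?thesis by linarith
  qed
  have [measurable]: "?g \<in> borel_measurable P" by measurable
  have "(\<integral>\<omega>. (avg N f \<omega>)\<^sup>2 \<partial>P) \<le> (\<integral>\<omega>. (avg N ?g \<omega>)\<^sup>2 + 2 * K * (translation_error K m N + translation_error K n N) \<partial>P)"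
    using pt by (intro integral_mono Bochner_Integration.integrable_add
      integrable_square[OF _ avg_bounded[OF f]] integrable_square[OF _ avg_bounded[OF g]]) auto
  also have "\<dots> = (\<integral>\<omega>. (avg N ?g \<omega>)\<^sup>2 \<partial>P) + 2 * K * (translation_error K m N + translation_error K n N)"
    using integrable_square[OF _ avg_bounded[OF g], of N] by (simp add: prob_space)
  also have "(\<integral>\<omega>. (avg N ?g \<omega>)\<^sup>2 \<partial>P) \<le> (\<integral>\<omega>. (?g \<omega>)\<^sup>2 \<partial>P)"
    using g by (intro integral_avg_square_le[where K = K] N) auto
  finally show ?thesis by simp
qed

lemma avg_L2_Cauchy:
  assumes [measurable]: "f \<in> borel_measurable P" and f: "\<forall>\<omega>\<in>space P. \<bar>f \<omega>\<bar> \<le> K"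
    and e: "0 < e"
  shows "\<exists>M. \<forall>m\<ge>M. \<forall>n\<ge>M. (\<integral>\<omega>. (avg m f \<omega> - avg n f \<omega>)\<^sup>2 \<partial>P) < e"
proof -
  let ?q = "\<lambda>n. \<integral>\<omega>. (avg n f \<omega>)\<^sup>2 \<partial>P"
  \<comment> \<open>The index 0 is excluded because \<open>avg 0 f\<close> is 0 by division by zero
    and would make the infimum trivial.\<close>
  define \<beta> where "\<beta> = (INF n\<in>{0<..}. ?q n)"
  have bdd: "bdd_below (?q ` {0<..})"
    by (rule bdd_belowI[of _ 0]) auto
  have lower: "\<beta> \<le> ?q n" if "0 < n" for n
    unfolding \<beta>_def using that by (intro cINF_lower[OF bdd]) auto
  \<comment> \<open>Although the midpoint is not an average over a box, its norm cannot fall below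
    the infimum: long averages of \<open>f\<close> are at most as large as the midpoint in norm, up
    to an error that vanishes with N.\<close>
  have comb: "\<beta> \<le> (\<integral>\<omega>. ((avg m f \<omega> + avg n f \<omega>) / 2)\<^sup>2 \<partial>P)" if "0 < m" "0 < n" for m n
  proof (rule tendsto_le[OF _ _ tendsto_const])
    let ?r = "\<integral>\<omega>. ((avg m f \<omega> + avg n f \<omega>) / 2)\<^sup>2 \<partial>P"
    have "(\<lambda>N. ?r + 2 * K * (translation_error K m N + translation_error K n N)) \<longlonglongrightarrow> ?r + 2 * K * (0 + 0)"
      by (intro tendsto_intros translation_error_tendsto)
    then show "(\<lambda>N. ?r + 2 * K * (translation_error K m N + translation_error K n N)) \<longlonglongrightarrow> ?r" by simp
    show "\<forall>\<^sub>F N in sequentially. \<beta> \<le> ?r + 2 * K * (translation_error K m N + translation_error K n N)"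
      using eventually_gt_at_top[of 0]
    proof eventually_elim
      case (elim N)
      show ?case
        by (rule order_trans[OF lower[OF elim] integral_avg_square_le_comb[OF assms(1) f that elim]])
    qed
  qed simp
  \<comment> \<open>One nearly minimal average forces all long averages to be nearly minimal, by the
    same comparison with both indices equal to m. The slack e/4 is what the identity 2a + 2b - 4c
    for the squared distance tolerates.\<close>
  have q_tendsto: "\<forall>\<^sub>F N in sequentially. ?q N < \<beta> + e / 4"
  proof -
    have "Inf (?q ` {0<..}) < \<beta> + e / 8"
      using e by (simp add: \<beta>_def)
    then obtain m where m: "0 < m" "?q m < \<beta> + e / 8"
      using cINF_less_iff[OF _ bdd, of "\<beta> + e / 8"] by auto
    have "(\<lambda>N. 2 * K * (translation_error K m N + translation_error K m N)) \<longlonglongrightarrow> 2 * K * (0 + 0)"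
      by (intro tendsto_intros translation_error_tendsto)
    then have "\<forall>\<^sub>F N in sequentially. 2 * K * (translation_error K m N + translation_error K m N) < e / 8"
      by (rule order_tendstoD(2)) (use e in simp)
    then show ?thesis
      using eventually_gt_at_top[of 0]
    proof eventually_elim
      case (elim N)
      then show ?case
        using integral_avg_square_le_comb[OF assms(1) f m(1) m(1) elim(2)] m(2) by simp
    qed
  qed
  then obtain M where M: "\<And>N. N \<ge> M \<Longrightarrow> ?q N < \<beta> + e / 4"
    by (auto simp: eventually_sequentially)
  have "(\<integral>\<omega>. (avg m f \<omega> - avg n f \<omega>)\<^sup>2 \<partial>P) < e" if "m \<ge> Suc M" "n \<ge> Suc M" for m n
  proof -
    have mid: "\<forall>\<omega>\<in>space P. \<bar>(avg m f \<omega> + avg n f \<omega>) / 2\<bar> \<le> K"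
    proof
      fix \<omega> assume "\<omega> \<in> space P"
      then show "\<bar>(avg m f \<omega> + avg n f \<omega>) / 2\<bar> \<le> K"
        using avg_abs_le[OF f, of \<omega> m] avg_abs_le[OF f, of \<omega> n] by (simp add: abs_le_iff)
    qed
    have I: "integrable P (\<lambda>\<omega>. (avg m f \<omega>)\<^sup>2)" "integrable P (\<lambda>\<omega>. (avg n f \<omega>)\<^sup>2)"
      "integrable P (\<lambda>\<omega>. ((avg m f \<omega> + avg n f \<omega>) / 2)\<^sup>2)"
      by (rule integrable_square[OF _ avg_bounded[OF f]] integrable_square[OF _ mid]; measurable)+
    have "(avg m f \<omega> - avg n f \<omega>)\<^sup>2 = 2 * (avg m f \<omega>)\<^sup>2 + 2 * (avg n f \<omega>)\<^sup>2
        - 4 * ((avg m f \<omega> + avg n f \<omega>) / 2)\<^sup>2" for \<omega>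
      by (simp add: power2_eq_square field_simps)
    then have "(\<integral>\<omega>. (avg m f \<omega> - avg n f \<omega>)\<^sup>2 \<partial>P)
        = 2 * ?q m + 2 * ?q n - 4 * (\<integral>\<omega>. ((avg m f \<omega> + avg n f \<omega>) / 2)\<^sup>2 \<partial>P)"
      using I by simp
    then show ?thesis
      using M[of m] M[of n] comb[of m n] that by simp
  qed
  then show ?thesis by blast
qed

end

text \<open>The familiar half of the Riesz-Fischer theorem: along a fast subsequence the increments
  have summable expectations, so they are almost surely absolutely summable.\<close>

lemma (in prob_space) L2_Cauchy_AE_convergent_subseq:
  fixes u :: "nat \<Rightarrow> 'a \<Rightarrow> real"
  assumes [measurable]: "\<And>n. u n \<in> borel_measurable M"
    and int: "\<And>n. integrable M (\<lambda>\<omega>. (u n \<omega>)\<^sup>2)"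
    and Cauchy: "\<And>e. 0 < e \<Longrightarrow> \<exists>N. \<forall>m\<ge>N. \<forall>n\<ge>N. (\<integral>\<omega>. (u m \<omega> - u n \<omega>)\<^sup>2 \<partial>M) < e"
  shows "\<exists>r. strict_mono r \<and> (AE \<omega> in M. convergent (\<lambda>j. u (r j) \<omega>))"
proof -
  have "\<exists>N. \<forall>m\<ge>N. \<forall>n\<ge>N. (\<integral>\<omega>. (u m \<omega> - u n \<omega>)\<^sup>2 \<partial>M) < (1/4) ^ j" for j :: nat
    by (rule Cauchy) simp
  then obtain N where N: "\<And>j m n. m \<ge> N j \<Longrightarrow> n \<ge> N j \<Longrightarrow> (\<integral>\<omega>. (u m \<omega> - u n \<omega>)\<^sup>2 \<partial>M) < (1/4) ^ j"
    by metis
  \<comment> \<open>The summand \<open>j\<close> makes the sequence strictly increasing; the partial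
    sum dominates \<open>N j\<close> at both \<open>j\<close> and \<open>Suc j\<close>.\<close>
  define r where "r j = j + (\<Sum>i\<le>j. N i)" for j
  have r: "strict_mono r"
    unfolding strict_mono_Suc_iff r_def by simp
  have rN: "N j \<le> r j" "N j \<le> r (Suc j)" for j
    unfolding r_def using member_le_sum[of j "{..j}" N] by simp_all
  let ?d = "\<lambda>j \<omega>. \<bar>u (r (Suc j)) \<omega> - u (r j) \<omega>\<bar>"
  have int_d: "integrable M (\<lambda>\<omega>. (?d j \<omega>)\<^sup>2)" for j
  proof (rule Bochner_Integration.integrable_bound)
    show "integrable M (\<lambda>\<omega>. 2 * (u (r (Suc j)) \<omega>)\<^sup>2 + 2 * (u (r j) \<omega>)\<^sup>2)"
      using int by simp
    have "(a - b)\<^sup>2 \<le> 2 * a\<^sup>2 + 2 * b\<^sup>2" for a b :: real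
      using zero_le_power2[of "a + b"] by (simp add: power2_eq_square algebra_simps)
    then show "AE \<omega> in M. norm ((?d j \<omega>)\<^sup>2) \<le> norm (2 * (u (r (Suc j)) \<omega>)\<^sup>2 + 2 * (u (r j) \<omega>)\<^sup>2)"
      by simp
  qed measurable
  have d: "(\<integral>\<^sup>+\<omega>. ennreal (?d j \<omega>) \<partial>M) \<le> ennreal (2 * (1/2) ^ j)" for j
  proof -
    \<comment> \<open>A weighted arithmetic-geometric mean bound in place of Cauchy-Schwarz. The
      weight 2^j is balanced against the squared distance (1/4)^j, so that both terms integrate to
      at most (1/2)^j.\<close>
    have le: "?d j \<omega> \<le> (1/2) ^ j + 2 ^ j * (?d j \<omega>)\<^sup>2" for \<omega>
    proof -
      have "2 * x * y \<le> x\<^sup>2 + y\<^sup>2" for x y :: real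
        using zero_le_power2[of "x - y"] by (simp add: power2_eq_square algebra_simps)
      from this[of "1" "2 ^ j * ?d j \<omega>"]
      have "2 ^ j * ?d j \<omega> * 2 \<le> 1 + (2 ^ j * ?d j \<omega>)\<^sup>2" by simp
      moreover have "0 \<le> 2 ^ j * ?d j \<omega>" by simp
      ultimately have "2 ^ j * ?d j \<omega> \<le> 1 + (2 ^ j * ?d j \<omega>)\<^sup>2" by linarith
      also have "\<dots> = 2 ^ j * ((1/2) ^ j + 2 ^ j * (?d j \<omega>)\<^sup>2)"
        by (simp add: power2_eq_square algebra_simps power_one_over)
      finally show ?thesis by simp
    qed
    have "(\<integral>\<^sup>+\<omega>. ennreal (?d j \<omega>) \<partial>M) \<le> (\<integral>\<^sup>+\<omega>. ennreal ((1/2) ^ j + 2 ^ j * (?d j \<omega>)\<^sup>2) \<partial>M)"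
      using le by (intro nn_integral_mono ennreal_leI)
    also have "\<dots> = ennreal (\<integral>\<omega>. (1/2) ^ j + 2 ^ j * (?d j \<omega>)\<^sup>2 \<partial>M)"
      using int_d by (intro nn_integral_eq_integral) auto
    also have "(\<integral>\<omega>. (1/2) ^ j + 2 ^ j * (?d j \<omega>)\<^sup>2 \<partial>M) = (1/2) ^ j + 2 ^ j * (\<integral>\<omega>. (?d j \<omega>)\<^sup>2 \<partial>M)"
      using int_d by (simp add: prob_space)
    also have "\<dots> \<le> (1/2) ^ j + 2 ^ j * (1/4) ^ j"
      using N[OF rN(2) rN(1), of j] by (intro add_left_mono mult_left_mono) (auto intro: less_imp_le)
    also have "2 ^ j * (1/4) ^ j = (1/2 :: real) ^ j"
      by (simp flip: power_mult_distrib)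
    finally show ?thesis by (simp add: ennreal_leI)
  qed
  have "(\<integral>\<^sup>+\<omega>. (\<Sum>j. ennreal (?d j \<omega>)) \<partial>M) = (\<Sum>j. \<integral>\<^sup>+\<omega>. ennreal (?d j \<omega>) \<partial>M)"
    by (rule nn_integral_suminf) measurable
  also have "\<dots> \<le> (\<Sum>j. ennreal (2 * (1/2) ^ j))"
    by (rule suminf_le[OF d]) auto
  also have "\<dots> < \<infinity>"
  proof -
    have "summable (\<lambda>j. 2 * (1/2 :: real) ^ j)"
      by (intro summable_mult summable_geometric) simp
    then show ?thesis
      by (simp add: suminf_ennreal2 less_top)
  qed
  finally have "AE \<omega> in M. (\<Sum>j. ennreal (?d j \<omega>)) \<noteq> \<infinity>"
    by (intro nn_integral_PInf_AE) auto
  then have "AE \<omega> in M. convergent (\<lambda>j. u (r j) \<omega>)"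
  proof eventually_elim
    case (elim \<omega>)
    then have "summable (\<lambda>j. ?d j \<omega>)"
      by (intro summable_suminf_not_top) (auto simp: less_top)
    then have "summable (\<lambda>j. u (r (Suc j)) \<omega> - u (r j) \<omega>)"
      by (rule summable_rabs_cancel)
    then have "convergent (\<lambda>n. \<Sum>j<n. u (r (Suc j)) \<omega> - u (r j) \<omega>)"
      by (simp add: summable_iff_convergent)
    then have "convergent (\<lambda>n. u (r n) \<omega> - u (r 0) \<omega>)"
      using sum_lessThan_telescope[of "\<lambda>j. u (r j) \<omega>"] by simp
    then have "convergent (\<lambda>n. (u (r n) \<omega> - u (r 0) \<omega>) + u (r 0) \<omega>)"
      by (intro convergent_add convergent_const)
    then show ?case by simp
  qed
  with r show ?thesis by blast
qed

section \<open>Maximal inequality and almost sure convergence\<close>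

context lattice_action
begin

text \<open>Transference: \<open>zbox_maximal\<close> is applied along the orbit of each point, with
  centres in a large window \<open>zbox R\<close>, and integrated. By invariance the two sides
  become multiples of the sizes of \<open>zbox R\<close> and \<open>zbox (R + L)\<close>. The bound
  \<open>L\<close> on the radii makes the ratio of these sizes tend to 1 as R grows.\<close>

lemma maximal_inequality_finite:
  assumes [measurable]: "g \<in> borel_measurable P" and g: "\<forall>\<omega>\<in>space P. 0 \<le> g \<omega> \<and> g \<omega> \<le> K" and e: "0 < e"
  shows "e * prob {\<omega> \<in> space P. \<exists>n\<in>{1..L}. e < avg n g \<omega>} \<le> 2 ^ CARD('n) * (\<integral>\<omega>. g \<omega> \<partial>P)"
proof -
  let ?E = "{\<omega> \<in> space P. \<exists>n\<in>{1..L}. e < avg n g \<omega>}"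
  let ?c = "\<lambda>n. real (card (zbox n :: (int^'n) set))"
  let ?C = "2 ^ CARD('n) * (\<integral>\<omega>. g \<omega> \<partial>P)"
  have E [measurable]: "?E \<in> sets P" by measurable
  have int_g: "integrable P (\<lambda>\<omega>. g (T z \<omega>))" for z
    using g T_space by (intro integrable_bounded[where K = K]) auto
  have "e * prob ?E \<le> ?C * (?c (R + L) / ?c R)" if R: "0 < R" for R
  proof -
    have pt: "e * (\<Sum>z\<in>zbox R. indicator ?E (T z \<omega>)) \<le> 2 ^ CARD('n) * (\<Sum>w\<in>zbox (R + L). g (T w \<omega>))"
      if \<omega>: "\<omega> \<in> space P" for \<omega>
    proof -
      define D where "D = {z \<in> zbox R. T z \<omega> \<in> ?E}"
      have "\<exists>\<rho>. \<forall>z\<in>D. \<rho> z \<in> {1..L} \<and> e < avg (\<rho> z) g (T z \<omega>)"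
        unfolding D_def by (intro bchoice) auto
      then obtain \<rho> where \<rho>: "\<And>z. z \<in> D \<Longrightarrow> \<rho> z \<in> {1..L} \<and> e < avg (\<rho> z) g (T z \<omega>)"
        by blast
      have "e * real (card D) \<le> 2 ^ CARD('n) * (\<Sum>w\<in>zbox (R + L). g (T w \<omega>))"
      proof (rule zbox_maximal)
        fix z assume z: "z \<in> D"
        show "0 < \<rho> z \<and> \<rho> z \<le> L" using \<rho>[OF z] by auto
        have "avg (\<rho> z) g (T z \<omega>) = (\<Sum>w\<in>zbox (\<rho> z). g (T (z + w) \<omega>)) / ?c (\<rho> z)"
          unfolding avg_def by (simp add: T_add[OF \<omega>] add.commute)
        then show "e * ?c (\<rho> z) \<le> (\<Sum>w\<in>zbox (\<rho> z). g (T (z + w) \<omega>))"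
          using \<rho>[OF z] card_zbox_pos[of "\<rho> z"] by (simp add: pos_less_divide_eq less_imp_le)
      qed (use g e T_space[OF \<omega>] in \<open>auto simp: D_def\<close>)
      also have "real (card D) = (\<Sum>z\<in>zbox R. indicator ?E (T z \<omega>))"
        unfolding D_def indicator_def of_bool_def
        using sum.inter_filter[of "zbox R" "\<lambda>_. 1 :: real" "\<lambda>z. T z \<omega> \<in> ?E"] by simp
      finally show ?thesis .
    qed
    have ind: "(\<integral>\<omega>. indicator ?E (T z \<omega>) \<partial>P) = prob ?E" for z
      using integral_T[of "indicator ?E" z] by simp
    have int_ind: "integrable P (\<lambda>\<omega>. indicator ?E (T z \<omega>) :: real)" for z
      by (intro integrable_bounded[where K = 1]) (auto simp: indicator_def)
    have "e * (?c R * prob ?E) = (\<integral>\<omega>. e * (\<Sum>z\<in>zbox R. indicator ?E (T z \<omega>)) \<partial>P)"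
      by (simp only: Bochner_Integration.integral_mult_right_zero Bochner_Integration.integral_sum[OF int_ind] ind
          sum_constant)
    also have "\<dots> \<le> (\<integral>\<omega>. 2 ^ CARD('n) * (\<Sum>w\<in>zbox (R + L). g (T w \<omega>)) \<partial>P)"
      using pt int_ind int_g by (intro integral_mono) auto
    also have "\<dots> = ?C * ?c (R + L)"
      using int_g integral_T[of g] by simp
    finally show ?thesis
      using card_zbox_pos[OF R] by (simp add: pos_le_divide_eq mult_ac)
  qed
  then have "\<forall>\<^sub>F R in sequentially. e * prob ?E \<le> ?C * (?c (R + L) / ?c R)"
    using eventually_gt_at_top[of 0] by (rule eventually_mono[rotated])
  moreover have "(\<lambda>R. ?C * (?c (R + L) / ?c R)) \<longlonglongrightarrow> ?C * 1"
    by (intro tendsto_mult tendsto_const zbox_scaled_tendsto)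
  ultimately show ?thesis
    using tendsto_lowerbound[of _ "?C * 1" sequentially "e * prob ?E"] by simp
qed

lemma maximal_inequality:
  assumes [measurable]: "g \<in> borel_measurable P" and g: "\<forall>\<omega>\<in>space P. 0 \<le> g \<omega> \<and> g \<omega> \<le> K" and e: "0 < e"
  shows "e * prob {\<omega> \<in> space P. \<exists>n\<ge>1. e < avg n g \<omega>} \<le> 2 ^ CARD('n) * (\<integral>\<omega>. g \<omega> \<partial>P)"
proof -
  let ?E = "\<lambda>L. {\<omega> \<in> space P. \<exists>n\<in>{1..L}. e < avg n g \<omega>}"
  have "(\<lambda>L. prob (?E L)) \<longlonglongrightarrow> prob (\<Union>L. ?E L)"
    by (rule finite_Lim_measure_incseq) (auto simp: incseq_def intro: le_trans)
  also have "(\<Union>L. ?E L) = {\<omega> \<in> space P. \<exists>n\<ge>1. e < avg n g \<omega>}"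
  proof safe
    fix \<omega> n assume "\<omega> \<in> space P" "(1::nat) \<le> n" "e < avg n g \<omega>"
    then show "\<omega> \<in> (\<Union>L. ?E L)" by (intro UN_I[of n]) auto
  qed auto
  finally have "(\<lambda>L. e * prob (?E L)) \<longlonglongrightarrow> e * prob {\<omega> \<in> space P. \<exists>n\<ge>1. e < avg n g \<omega>}"
    by (intro tendsto_mult tendsto_const)
  then show ?thesis
    by (rule tendsto_upperbound) (use maximal_inequality_finite[OF assms] in auto)
qed

text \<open>The hypothesis \<open>erg\<close> asks only that almost sure limits of averages along
  subsequences be constant. This is weaker than ergodicity of the lattice action and is what
  ergodicity under real translations can deliver.\<close>

theorem pointwise_ergodic:
  assumes [measurable]: "f \<in> borel_measurable P" and f: "\<forall>\<omega>\<in>space P. \<bar>f \<omega>\<bar> \<le> K"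
    and erg: "\<And>r. strict_mono r \<Longrightarrow> AE \<omega> in P. convergent (\<lambda>j. avg (r j) f \<omega>) \<Longrightarrow>
      \<exists>c. AE \<omega> in P. (\<lambda>j. avg (r j) f \<omega>) \<longlonglongrightarrow> c"
  shows "AE \<omega> in P. (\<lambda>n. avg n f \<omega>) \<longlonglongrightarrow> (\<integral>\<omega>. f \<omega> \<partial>P)"
proof -
  have "\<exists>r. strict_mono r \<and> (AE \<omega> in P. convergent (\<lambda>j. avg (r j) f \<omega>))"
    using avg_L2_Cauchy[OF assms(1) f] integrable_square[OF _ avg_bounded[OF f]]
    by (intro L2_Cauchy_AE_convergent_subseq) auto
  then obtain r c where r: "strict_mono r" and c: "AE \<omega> in P. (\<lambda>j. avg (r j) f \<omega>) \<longlonglongrightarrow> c"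
    using erg by blast
  have "(\<lambda>j. \<integral>\<omega>. avg (r j) f \<omega> \<partial>P) \<longlonglongrightarrow> (\<integral>\<omega>. c \<partial>P)"
    by (rule integral_dominated_convergence[where w = "\<lambda>_. K"])
      (use c avg_bounded[OF f] in auto)
  moreover have "\<forall>\<^sub>F j in sequentially. (\<integral>\<omega>. avg (r j) f \<omega> \<partial>P) = (\<integral>\<omega>. f \<omega> \<partial>P)"
    using eventually_gt_at_top[of 0]
  proof eventually_elim
    case (elim j)
    then show ?case
      using strict_mono_imp_increasing[OF r, of j] by (intro integral_avg[OF _ f]) auto
  qed
  ultimately have "(\<lambda>j. \<integral>\<omega>. f \<omega> \<partial>P) \<longlonglongrightarrow> c"
    by (auto simp: prob_space intro: Lim_transform_eventually)
  then have c_eq: "c = (\<integral>\<omega>. f \<omega> \<partial>P)"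
    by (simp add: LIMSEQ_const_iff)
  have L1: "(\<lambda>j. \<integral>\<omega>. \<bar>avg (r j) f \<omega> - c\<bar> \<partial>P) \<longlonglongrightarrow> (\<integral>\<omega>. 0 \<partial>P)"
  proof (rule integral_dominated_convergence[where w = "\<lambda>_. K + \<bar>c\<bar>"])
    show "AE \<omega> in P. (\<lambda>j. \<bar>avg (r j) f \<omega> - c\<bar>) \<longlonglongrightarrow> 0"
      using c by eventually_elim (auto intro: tendsto_rabs_zero LIM_zero)
    show "AE \<omega> in P. norm \<bar>avg (r j) f \<omega> - c\<bar> \<le> K + \<bar>c\<bar>" for j
      using avg_bounded[OF f, of "r j"] by (intro AE_I2) force
  qed auto
  have close: "AE \<omega> in P. \<forall>\<^sub>F n in sequentially. \<bar>avg n f \<omega> - c\<bar> \<le> 2 * e" if e: "0 < e" for e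
  proof -
    let ?D = "{\<omega> \<in> space P. \<not> (\<forall>\<^sub>F n in sequentially. \<bar>avg n f \<omega> - c\<bar> \<le> 2 * e)}"
    have D [measurable]: "?D \<in> sets P"
      unfolding eventually_sequentially by measurable
    have "e * prob ?D \<le> 2 ^ CARD('n) * (\<integral>\<omega>. \<bar>avg (r j) f \<omega> - c\<bar> \<partial>P)" if j: "0 < j" for j
    proof -
      let ?g = "\<lambda>\<omega>. \<bar>avg (r j) f \<omega> - c\<bar>"
      have rj: "0 < r j" using strict_mono_imp_increasing[OF r, of j] j by simp
      \<comment> \<open>For large n the average of \<open>f\<close> is within e of the average of
        \<open>avg (r j) f\<close>, so deviations above 2e for infinitely many n force some average
        of \<open>?g\<close> above e. The event \<open>?D\<close> does not involve j, while the
        integral of \<open>?g\<close> tends to 0 with j; hence \<open>?D\<close> is null.\<close>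
      have "?D \<subseteq> {\<omega> \<in> space P. \<exists>n\<ge>1. e < avg n ?g \<omega>}"
      proof (rule subsetI, rule ccontr)
        fix \<omega> assume D: "\<omega> \<in> ?D" and "\<omega> \<notin> {\<omega> \<in> space P. \<exists>n\<ge>1. e < avg n ?g \<omega>}"
        then have \<omega>: "\<omega> \<in> space P" and le: "\<And>n. 1 \<le> n \<Longrightarrow> avg n ?g \<omega> \<le> e"
          by (auto simp: not_less)
        have "\<forall>\<^sub>F n in sequentially. translation_error K (r j) n < e"
          using translation_error_tendsto e by (rule order_tendstoD(2))
        then have "\<forall>\<^sub>F n in sequentially. \<bar>avg n f \<omega> - c\<bar> \<le> 2 * e"
          using eventually_ge_at_top[of 1]
        proof eventually_elim
          case (elim n)
          have "avg n (avg (r j) f) \<omega> - c = avg n (\<lambda>\<omega>. avg (r j) f \<omega> - c) \<omega>"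
            using zbox_nonempty[of n] elim(2) unfolding avg_def[of n] by (simp add: sum_subtractf diff_divide_distrib)
          moreover have "\<bar>avg n (\<lambda>\<omega>. avg (r j) f \<omega> - c) \<omega>\<bar> \<le> avg n ?g \<omega>"
            unfolding avg_def[of n] abs_divide by (simp add: divide_right_mono sum_abs)
          ultimately show ?case
            using avg_avg[OF f \<omega> rj, of n] elim(1) le[OF elim(2)] by linarith
        qed
        with D show False by simp
      qed
      then have "prob ?D \<le> prob {\<omega> \<in> space P. \<exists>n\<ge>1. e < avg n ?g \<omega>}"
        by (intro finite_measure_mono) measurable
      then have "e * prob ?D \<le> e * prob {\<omega> \<in> space P. \<exists>n\<ge>1. e < avg n ?g \<omega>}"
        using e by (intro mult_left_mono) auto
      also have "\<dots> \<le> 2 ^ CARD('n) * (\<integral>\<omega>. ?g \<omega> \<partial>P)"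
      proof (rule maximal_inequality[OF _ _ e])
        show "\<forall>\<omega>\<in>space P. 0 \<le> ?g \<omega> \<and> ?g \<omega> \<le> K + \<bar>c\<bar>"
          using avg_bounded[OF f, of "r j"] by force
      qed measurable
      finally show ?thesis .
    qed
    then have "\<forall>\<^sub>F j in sequentially. e * prob ?D \<le> 2 ^ CARD('n) * (\<integral>\<omega>. \<bar>avg (r j) f \<omega> - c\<bar> \<partial>P)"
      using eventually_gt_at_top[of 0] by (rule eventually_mono[rotated])
    moreover have "(\<lambda>j. 2 ^ CARD('n) * (\<integral>\<omega>. \<bar>avg (r j) f \<omega> - c\<bar> \<partial>P)) \<longlonglongrightarrow> 2 ^ CARD('n) * 0"
      using L1 by (intro tendsto_mult tendsto_const) simp
    ultimately have "e * prob ?D \<le> 2 ^ CARD('n) * 0"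
      by (intro tendsto_lowerbound) auto
    then have "prob ?D = 0"
      using e measure_nonneg[of P ?D] by (simp add: mult_le_0_iff)
    then show ?thesis
      by (subst AE_iff_measurable[OF D]) (auto simp: emeasure_eq_measure)
  qed
  have "AE \<omega> in P. \<forall>i::nat. \<forall>\<^sub>F n in sequentially. \<bar>avg n f \<omega> - c\<bar> \<le> 2 * (1 / real (Suc i))"
    by (subst AE_all_countable, rule allI, rule close) simp
  then show ?thesis
  proof eventually_elim
    case (elim \<omega>)
    show ?case
    proof (rule tendstoI)
      fix e :: real assume "0 < e"
      then obtain i where i: "1 / real (Suc i) < e / 2"
        using nat_approx_posE[of "e / 2"] by auto
      from elim have "\<forall>\<^sub>F n in sequentially. \<bar>avg n f \<omega> - c\<bar> \<le> 2 * (1 / real (Suc i))" by blast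
      then show "\<forall>\<^sub>F n in sequentially. dist (avg n f \<omega>) (\<integral>\<omega>. f \<omega> \<partial>P) < e"
        by (rule eventually_mono) (use i in \<open>simp add: dist_real_def c_eq\<close>)
    qed
  qed
qed

end

subsection \<open>Poisson laws\<close>

text \<open>The process is replaced by its law on configurations. The void probabilities yield
  equality and independence statements through the intersection-stable generator; the second moments
  control variances.\<close>

locale poisson_law = prob_space Q for Q :: "(real^'n) set measure" +
  fixes lam :: real
  assumes sets_Q [measurable_cong]: "sets Q = sets configs"
    and void_prob: "\<And>B. B \<in> sets borel \<Longrightarrow> bounded B \<Longrightarrow>
      prob {A. loc_fin A \<and> A \<inter> B = {}} = exp (- (lam * measure lborel B))"
    and square_integrable: "\<And>B. B \<in> sets borel \<Longrightarrow> bounded B \<Longrightarrow>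
      integrable Q (\<lambda>A. (real (card (A \<inter> B)))\<^sup>2)"
begin

lemma space_Q: "space Q = Collect loc_fin"
  using sets_eq_imp_space_eq[OF sets_Q] by (simp add: space_configs)

lemma translate_Q [measurable]: "(\<lambda>A. (+) v ` A) \<in> measurable Q configs"
  using translate_measurable by (simp add: measurable_cong_sets[OF sets_Q refl])

lemma void_eventE:
  assumes "E \<in> void_events"
  obtains B :: "(real^'n) set" where "E = {A. loc_fin A \<and> A \<inter> B = {}}" "B \<in> sets borel" "bounded B"
  using assms unfolding void_events_def by blast

lemma borel_translate: "B \<in> sets borel \<Longrightarrow> {x. v + x \<in> B} \<in> sets borel" for v :: "real^'n"
  using measurable_sets[of "(+) v" borel borel B] by (simp add: vimage_def)

text \<open>The translated law has the same void probabilities because Lebesgue measure is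
  translation invariant, and these determine the law.\<close>

lemma stationary_Q: "distr Q configs (\<lambda>A. (+) v ` A) = Q"
proof (rule measure_eqI_generator_eq[OF Int_stable_void_events void_events_Pow])
  fix E :: "(real^'n) set set" assume "E \<in> void_events"
  then obtain B where B: "E = {A. loc_fin A \<and> A \<inter> B = {}}" "B \<in> sets borel" "bounded B"
    by (rule void_eventE)
  have E: "E \<in> sets configs"
    unfolding sets_configs_void using \<open>E \<in> void_events\<close> by (rule sigma_sets.Basic)
  have "measure lborel {x. v + x \<in> B} = measure (distr lborel borel ((+) v)) B"
    using B(2) by (subst measure_distr) (auto simp: vimage_def)
  then have vol: "measure lborel {x. v + x \<in> B} = measure lborel B"
    by (simp add: lborel_distr_plus)
  have "(\<lambda>A. (+) v ` A) -` E \<inter> space Q = {A. loc_fin A \<and> A \<inter> {x. v + x \<in> B} = {}}"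
    unfolding B(1) space_Q using loc_fin_translate[of _ v] by (auto simp: translate_Int)
  then have "measure (distr Q configs (\<lambda>A. (+) v ` A)) E = prob {A. loc_fin A \<and> A \<inter> {x. v + x \<in> B} = {}}"
    using E by (subst measure_distr) auto
  also have "\<dots> = prob E"
    unfolding B(1) using B(2,3) by (simp add: void_prob borel_translate bounded_translate_vimage vol)
  finally show "emeasure (distr Q configs (\<lambda>A. (+) v ` A)) E = emeasure Q E"
    using prob_space.finite_measure[OF prob_space_distr[OF translate_Q]]
    by (simp add: emeasure_eq_measure finite_measure.emeasure_eq_measure)
next
  show "range (\<lambda>_::nat. Collect loc_fin) \<subseteq> void_events"
    unfolding void_events_def by (auto intro!: exI[of _ "{}"])
  show "(\<Union>i::nat. Collect loc_fin) = Collect (loc_fin :: (real^'n) set \<Rightarrow> bool)" by simp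
  show "emeasure (distr Q configs (\<lambda>A. (+) v ` A)) (Collect loc_fin) \<noteq> \<infinity>"
    using prob_space.finite_measure[OF prob_space_distr[OF translate_Q]]
    by (simp add: finite_measure.emeasure_eq_measure)
qed (simp_all add: sets_Q sets_configs_void)

lemma integral_translate:
  fixes f :: "(real^'n) set \<Rightarrow> real"
  assumes "f \<in> borel_measurable configs"
  shows "(\<integral>A. f ((+) v ` A) \<partial>Q) = (\<integral>A. f A \<partial>Q)"
  using integral_distr[OF translate_Q assms, of v] stationary_Q[of v] by simp

lemma Int_Q: "B \<in> sets borel \<Longrightarrow> (\<lambda>A. A \<inter> B) \<in> measurable Q configs"
  using Int_measurable by (simp add: measurable_cong_sets[OF sets_Q refl])

text \<open>For disjoint regions the void probability of a union is the product of the void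
  probabilities, since volumes add in the exponent. Pulled-back void events are an
  intersection-stable generator, so independence extends to the whole restricted configurations;
  this is the form needed for hop counts, which depend on positions and not only on numbers of
  points.\<close>

lemma indep_restrict:
  assumes B: "B \<in> sets borel" and C: "C \<in> sets borel" and BC: "B \<inter> C = {}"
  shows "indep_var configs (\<lambda>A. A \<inter> B) configs (\<lambda>A. A \<inter> C)"
proof -
  let ?V = "\<lambda>B. {(\<lambda>A. A \<inter> B) -` E \<inter> space Q | E. E \<in> (void_events :: (real^'n) set set set)}"
  have V_eq: "?V B = {{A. loc_fin A \<and> A \<inter> (B \<inter> D) = {}} | D. D \<in> sets borel \<and> bounded D}" for B
  proof -
    have "(\<lambda>A. A \<inter> B) -` {A. loc_fin A \<and> A \<inter> D = {}} \<inter> space Q = {A. loc_fin A \<and> A \<inter> (B \<inter> D) = {}}" for D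
      using loc_fin_subset[OF _ Int_lower1] unfolding space_Q by (auto simp: Int_assoc)
    then show ?thesis
      unfolding void_events_def by blast
  qed
  have V_sets: "?V B \<subseteq> sets Q" if "B \<in> sets borel" for B
  proof safe
    fix E :: "(real^'n) set set" assume "E \<in> void_events"
    then have "E \<in> sets configs"
      unfolding sets_configs_void by (rule sigma_sets.Basic)
    then show "(\<lambda>A. A \<inter> B) -` E \<inter> space Q \<in> sets Q"
      by (rule measurable_sets[OF Int_Q[OF that]])
  qed
  have V_stable: "Int_stable (?V B)" for B
  proof (rule Int_stableI)
    fix a b assume "a \<in> ?V B" "b \<in> ?V B"
    then obtain E F where EF: "a = (\<lambda>A. A \<inter> B) -` E \<inter> space Q" "b = (\<lambda>A. A \<inter> B) -` F \<inter> space Q"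
      "E \<in> void_events" "F \<in> void_events" by blast
    then have "E \<inter> F \<in> void_events"
      using Int_stable_void_events unfolding Int_stable_def by blast
    moreover have "a \<inter> b = (\<lambda>A. A \<inter> B) -` (E \<inter> F) \<inter> space Q"
      unfolding EF by blast
    ultimately show "a \<inter> b \<in> ?V B" by blast
  qed
  have V_Pow: "?V B \<subseteq> Pow (space Q)" for B
    by blast
  have "indep_set (?V B) (?V C)"
  proof (rule indep_setI)
    fix a b assume "a \<in> ?V B" "b \<in> ?V C"
    then obtain D E where DE: "a = {A. loc_fin A \<and> A \<inter> (B \<inter> D) = {}}" "D \<in> sets borel" "bounded D"
      "b = {A. loc_fin A \<and> A \<inter> (C \<inter> E) = {}}" "E \<in> sets borel" "bounded E"
      unfolding V_eq by blast
    have bd: "bounded (B \<inter> D)" "bounded (C \<inter> E)" "B \<inter> D \<in> sets borel" "C \<inter> E \<in> sets borel"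
      using DE B C by auto
    have "a \<inter> b = {A. loc_fin A \<and> A \<inter> (B \<inter> D \<union> C \<inter> E) = {}}"
      using DE(1,4) by auto
    then have "prob (a \<inter> b) = exp (- (lam * measure lborel (B \<inter> D \<union> C \<inter> E)))"
      using bd by (simp add: void_prob)
    also have "measure lborel (B \<inter> D \<union> C \<inter> E) = measure lborel (B \<inter> D) + measure lborel (C \<inter> E)"
      using bd BC emeasure_bounded_finite[of "B \<inter> D"] emeasure_bounded_finite[of "C \<inter> E"]
      by (intro measure_Union) auto
    finally show "prob (a \<inter> b) = prob a * prob b"
      using bd DE(1,4) by (simp add: void_prob exp_add[symmetric] algebra_simps)
  qed (use V_sets B C in auto)
  then have "indep_set (sigma_sets (space Q) (?V B)) (sigma_sets (space Q) (?V C))"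
    by (rule indep_set_sigma_sets[OF _ V_stable V_stable])
  moreover have "{(\<lambda>A. A \<inter> B) -` E \<inter> space Q | E. E \<in> sets configs} = sigma_sets (space Q) (?V B)"
    if "B \<in> sets borel" for B
    unfolding sets_configs_void
    using sigma_sets_vimage_commute[of "\<lambda>A. A \<inter> B" "space Q" "Collect loc_fin" void_events]
      measurable_space[OF Int_Q[OF that]] by (auto simp: space_configs)
  ultimately show ?thesis
    unfolding indep_var_eq using B C Int_Q by (simp add: sigma_sets_sigma_sets_eq[OF V_Pow])
qed

end

lemma poisson_square_integrable:
  assumes "prob_space M" and [measurable]: "N \<in> measurable M (count_space (UNIV :: nat set))"
    and pr: "\<And>m. measure M {\<omega> \<in> space M. N \<omega> = m} = \<mu> ^ m / fact m * exp (- \<mu>)" and \<mu>: "0 \<le> \<mu>"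
  shows "integrable M (\<lambda>\<omega>. (real (N \<omega>))\<^sup>2)"
proof -
  interpret prob_space M by fact
  have "(\<integral>\<^sup>+\<omega>. ennreal ((real (N \<omega>))\<^sup>2) \<partial>M) = (\<integral>\<^sup>+\<omega>. (\<Sum>m. ennreal ((real m)\<^sup>2) * indicator {\<omega> \<in> space M. N \<omega> = m} \<omega>) \<partial>M)"
  proof (rule nn_integral_cong)
    fix \<omega> assume "\<omega> \<in> space M"
    then have "(\<Sum>m. ennreal ((real m)\<^sup>2) * indicator {\<omega> \<in> space M. N \<omega> = m} \<omega>)
        = (\<Sum>m\<in>{N \<omega>}. ennreal ((real m)\<^sup>2) * indicator {\<omega> \<in> space M. N \<omega> = m} \<omega>)"
      by (intro suminf_finite) (auto simp: indicator_def)
    then show "ennreal ((real (N \<omega>))\<^sup>2) = (\<Sum>m. ennreal ((real m)\<^sup>2) * indicator {\<omega> \<in> space M. N \<omega> = m} \<omega>)"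
      using \<open>\<omega> \<in> space M\<close> by (simp add: indicator_def)
  qed
  also have "\<dots> = (\<Sum>m. ennreal ((real m)\<^sup>2) * emeasure M {\<omega> \<in> space M. N \<omega> = m})"
    by (subst nn_integral_suminf) (auto simp: nn_integral_cmult)
  also have "\<dots> = (\<Sum>m. ennreal ((real m)\<^sup>2 * (\<mu> ^ m / fact m * exp (- \<mu>))))"
    using \<mu> by (simp only: emeasure_eq_measure pr) (simp add: ennreal_mult flip: times_divide_eq_right)
  also have "\<dots> < \<infinity>"
  proof -
    \<comment> \<open>From m <= 2^m one gets m^2 <= 4^m, so the second moment is dominated by an
      exponential series at 4 times the rate.\<close>
    have "summable (\<lambda>m. (4 * \<mu>) ^ m /\<^sub>R fact m)"
      by (rule summable_exp_generic)
    then have "summable (\<lambda>m. exp (- \<mu>) * ((4 * \<mu>) ^ m / fact m))"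
      by (intro summable_mult) (simp add: divide_inverse mult.commute)
    then have "summable (\<lambda>m. (real m)\<^sup>2 * (\<mu> ^ m / fact m * exp (- \<mu>)))"
    proof (rule summable_comparison_test'[where N = 0])
      fix m :: nat
      have "real m \<le> 2 ^ m" using less_exp[of m] by (metis less_imp_le of_nat_le_iff of_nat_numeral of_nat_power)
      then have "(real m)\<^sup>2 \<le> (2 ^ m)\<^sup>2" by (intro power_mono) auto
      also have "(2 ^ m)\<^sup>2 = (4 :: real) ^ m" by (simp add: power2_eq_square flip: power_mult_distrib)
      finally have "(real m)\<^sup>2 * (\<mu> ^ m / fact m * exp (- \<mu>)) \<le> 4 ^ m * (\<mu> ^ m / fact m * exp (- \<mu>))"
        using \<mu> by (intro mult_right_mono) auto
      then show "norm ((real m)\<^sup>2 * (\<mu> ^ m / fact m * exp (- \<mu>))) \<le> exp (- \<mu>) * ((4 * \<mu>) ^ m / fact m)"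
        using \<mu> by (simp add: power_mult_distrib mult_ac)
    qed
    then show ?thesis
      using \<mu> by (simp add: suminf_ennreal2 less_top)
  qed
  finally show ?thesis
    by (intro integrableI_bounded) auto
qed

lemma poisson_process_law:
  fixes X :: "'w \<Rightarrow> (real^'n) set"
  assumes M: "prob_space M" and lam: "0 < lam" and X: "poisson_process M lam X"
  shows "poisson_law (distr M configs X) lam"
proof -
  interpret prob_space M by fact
  have X_meas [measurable]: "X \<in> measurable M configs"
    using X unfolding poisson_process_def point_process_def by blast
  have count: "prob {\<omega> \<in> space M. card (X \<omega> \<inter> B) = m}
      = (lam * measure lborel B) ^ m / fact m * exp (- (lam * measure lborel B))"
    if "B \<in> sets borel" "bounded B" for B :: "(real^'n) set" and m
    using X that unfolding poisson_process_def by blast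
  interpret Q: prob_space "distr M configs X"
    by (rule prob_space_distr) measurable
  show ?thesis
  proof unfold_locales
    fix B :: "(real^'n) set" assume B: "B \<in> sets borel" "bounded B"
    have "{A. loc_fin A \<and> A \<inter> B = {}} \<in> sets configs"
      unfolding sets_configs_void void_events_def using B by (intro sigma_sets.Basic) blast
    moreover have "X -` {A. loc_fin A \<and> A \<inter> B = {}} \<inter> space M = {\<omega> \<in> space M. card (X \<omega> \<inter> B) = 0}"
      using measurable_space[OF X_meas] loc_finD[OF _ B(2)] by (auto simp: space_configs card_eq_0_iff)
    ultimately show "Q.prob {A. loc_fin A \<and> A \<inter> B = {}} = exp (- (lam * measure lborel B))"
      using count[OF B, of 0] by (simp add: measure_distr)
    have N: "(\<lambda>A. card (A \<inter> B)) \<in> measurable configs (count_space UNIV)"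
      by (rule card_Int_measurable[OF B])
    have "integrable M (\<lambda>\<omega>. (real (card (X \<omega> \<inter> B)))\<^sup>2)"
      using lam by (intro poisson_square_integrable[OF M measurable_compose[OF X_meas N] count[OF B]]) auto
    then show "integrable (distr M configs X) (\<lambda>A. (real (card (A \<inter> B)))\<^sup>2)"
      using measurable_compose[OF N, of "\<lambda>m. (real m)\<^sup>2" borel] by (subst integrable_distr_eq) auto
  qed simp
qed

subsection \<open>Fluctuations of the hop count around its mean\<close>

definition cells :: "(int^'n) set \<Rightarrow> (real^'n) set" where
  "cells Z = {x. cell_index 2 x \<in> Z}"

lemma cells_borel:
  assumes "finite (Z :: (int^'n) set)"
  shows "cells Z \<in> sets borel"
proof -
  have "cells Z = (\<Union>z\<in>Z. {x. cell_index 2 x = z})"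
    unfolding cells_def by auto
  then show ?thesis
    using assms by (simp add: sets.finite_UN cell_index_borel)
qed

lemma cell_index_translate:
  assumes "\<And>i. 2 * v $ i = of_int (w $ i)"
  shows "cell_index 2 (v + x) = w + cell_index 2 x"
proof (unfold vec_eq_iff, intro allI)
  fix i
  have "2 * (v + x) $ i = 2 * x $ i + of_int (w $ i)"
    using assms[of i] by (simp add: algebra_simps)
  then show "cell_index 2 (v + x) $ i = (w + cell_index 2 x) $ i"
    unfolding cell_index_def by simp
qed

text \<open>Distance k changes each doubled coordinate by at most the integer 2k, hence its floor by
  at most 2k. The extra 1 is there because \<open>zbox\<close> excludes its upper end.\<close>

lemma cell_index_near:
  assumes "norm (x - p) \<le> real k"
  shows "cell_index 2 p - cell_index 2 x \<in> zbox (2 * k + 1)"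
  unfolding zbox_def
proof (intro CollectI allI)
  fix i
  have "\<bar>x $ i - p $ i\<bar> \<le> real k"
    using order_trans[OF component_le_norm_cart[of "x - p" i] assms] by simp
  then have "\<bar>2 * p $ i - 2 * x $ i\<bar> \<le> real_of_int (2 * int k)" by auto
  then have "2 * p $ i < of_int \<lfloor>2 * x $ i\<rfloor> + 2 * real k + 1" "of_int \<lfloor>2 * x $ i\<rfloor> - 2 * real k \<le> 2 * p $ i"
    unfolding abs_le_iff of_int_mult by simp_all linarith+
  then have "2 * p $ i < of_int (\<lfloor>2 * x $ i\<rfloor> + 2 * int k + 1)" "of_int (\<lfloor>2 * x $ i\<rfloor> - 2 * int k) \<le> 2 * p $ i"
    by simp_all
  then have "\<lfloor>2 * p $ i\<rfloor> < \<lfloor>2 * x $ i\<rfloor> + 2 * int k + 1" "\<lfloor>2 * x $ i\<rfloor> - 2 * int k \<le> \<lfloor>2 * p $ i\<rfloor>"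
    by (simp_all only: floor_less_iff le_floor_iff)
  then show "- int (2 * k + 1) \<le> (cell_index 2 p - cell_index 2 x) $ i \<and>
      (cell_index 2 p - cell_index 2 x) $ i < int (2 * k + 1)"
    by (simp add: cell_index_def)
qed

lemma bounded_cells:
  assumes "finite (Z :: (int^'n) set)"
  shows "bounded (cells Z)"
proof -
  have "bounded {x :: real^'n. cell_index 2 x = z}" for z
  proof (rule bounded_subset[OF bounded_cbox], rule subsetI)
    fix x :: "real^'n" assume "x \<in> {x. cell_index 2 x = z}"
    then have z: "z = cell_index 2 x" by simp
    have "of_int (z $ i) / 2 \<le> x $ i \<and> x $ i \<le> (of_int (z $ i) + 1) / 2" for i
    proof -
      have "of_int (z $ i) \<le> 2 * x $ i" "2 * x $ i < of_int (z $ i) + 1"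
        using floor_correct[of "2 * x $ i"] unfolding z cell_index_def by simp_all
      then show ?thesis by simp
    qed
    then show "x \<in> cbox (\<chi> i. of_int (z $ i) / 2) (\<chi> i. (of_int (z $ i) + 1) / 2)"
      by (simp add: mem_box_cart)
  qed
  moreover have "cells Z = (\<Union>z\<in>Z. {x. cell_index 2 x = z})"
    unfolding cells_def by auto
  ultimately show ?thesis
    using bounded_UN[OF assms, of "\<lambda>z. {x. cell_index 2 x = z}"] by simp
qed

lemma near_count_cells:
  assumes A: "loc_fin A" and Z: "finite (Z :: (int^'n) set)"
  shows "near_count k r (cells Z) A S = (\<Sum>z\<in>Z. near_count k r (cells {z}) A S)"
proof -
  let ?P = "\<lambda>z. {x \<in> A \<inter> cells {z}. \<exists>j<k. near A S r j x}"
  have "{x \<in> A \<inter> cells Z. \<exists>j<k. near A S r j x} = (\<Union>z\<in>Z. ?P z)"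
    unfolding cells_def by auto
  moreover have "finite (?P z)" for z
    by (rule finite_subset[OF _ loc_finD[OF A bounded_cells[of "{z}"]]]) auto
  ultimately show ?thesis
    unfolding near_count_def using Z by (simp add: card_UN_disjoint cells_def disjoint_iff)
qed

lemma near_count_measurable_left:
  assumes "B \<in> sets borel" "bounded B" "loc_fin S"
  shows "(\<lambda>A. real (near_count k r B A S)) \<in> borel_measurable configs"
  using measurable_compose[OF measurable_Pair2'[of S configs configs] near_count_measurable[OF assms(1,2), of k r]]
    assms(3) by (simp add: space_configs)

lemma near_count_measurable_fst:
  assumes "finite (Z :: (int^'n) set)" "loc_fin S"
  shows "(\<lambda>A. real (near_count k r (cells Z) A S)) \<in> borel_measurable configs"
  by (rule near_count_measurable_left[OF cells_borel[OF assms(1)] bounded_cells[OF assms(1)] assms(2)])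

lemma scaled_zbox_card: "real (card (zbox n :: (int^'n) set)) = 2 ^ CARD('n) * real n ^ CARD('n)"
  by (simp add: card_zbox power_mult_distrib)

section \<open>Second-moment estimates for counts in cells\<close>

context poisson_law
begin

text \<open>One constant serves all later bounds: as hop counts are at most point counts, it bounds
  variances, covariances and, because m <= m^2 for naturals, also means, uniformly in the cell and
  in \<open>S\<close>.\<close>

definition cell_moment :: real where
  "cell_moment = (\<integral>A. (real (card (A \<inter> cells {0 :: int^'n})))\<^sup>2 \<partial>Q)"

lemma card_measurable_Q: "B \<in> sets borel \<Longrightarrow> bounded B \<Longrightarrow> (\<lambda>A. real (card (A \<inter> B))) \<in> borel_measurable Q"
  using measurable_compose[OF card_Int_measurable, of B real borel]
  by (simp add: measurable_cong_sets[OF sets_Q refl])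

lemma integral_card_square: "(\<integral>A. (real (card (A \<inter> cells {z})))\<^sup>2 \<partial>Q) = cell_moment"
proof -
  define v :: "real^'n" where "v = (\<chi> i. of_int (z $ i) / 2)"
  have "cell_index 2 (v + x) = z + cell_index 2 x" for x
    by (rule cell_index_translate) (simp add: v_def)
  then have "{x. v + x \<in> cells {z}} = cells {0}"
    by (auto simp: cells_def)
  then have "cell_moment = (\<integral>A. (real (card ((+) v ` A \<inter> cells {z})))\<^sup>2 \<partial>Q)"
    unfolding cell_moment_def card_translate_Int by simp
  also have "\<dots> = (\<integral>A. (real (card (A \<inter> cells {z})))\<^sup>2 \<partial>Q)"
    using card_measurable_Q[OF cells_borel bounded_cells, of "{z}"]
    by (intro integral_translate) (simp add: measurable_cong_sets[OF sets_Q refl])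
  finally show ?thesis by simp
qed

lemma near_count_measurable_Q:
  assumes "finite (Z :: (int^'n) set)" "loc_fin S"
  shows "(\<lambda>A. real (near_count k r (cells Z) A S)) \<in> borel_measurable Q"
  using near_count_measurable_fst[OF assms] by (simp add: measurable_cong_sets[OF sets_Q refl])

lemma near_count_square_le:
  assumes "A \<in> space Q" "finite (Z :: (int^'n) set)"
  shows "(real (near_count k r (cells Z) A S))\<^sup>2 \<le> (real (card (A \<inter> cells Z)))\<^sup>2"
  using near_count_le_card[of A "cells Z"] assms bounded_cells
  by (intro power_mono) (auto simp: space_Q)

lemma near_count_square_integrable:
  assumes Z: "finite (Z :: (int^'n) set)" "loc_fin S"
  shows "integrable Q (\<lambda>A. (real (near_count k r (cells Z) A S))\<^sup>2)"
proof (rule Bochner_Integration.integrable_bound)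
  show "integrable Q (\<lambda>A. (real (card (A \<inter> cells Z)))\<^sup>2)"
    using square_integrable[OF cells_borel bounded_cells] Z by simp
  show "(\<lambda>A. (real (near_count k r (cells Z) A S))\<^sup>2) \<in> borel_measurable Q"
    using near_count_measurable_Q[OF Z] by (rule borel_measurable_power)
qed (use near_count_square_le[OF _ Z(1)] in auto)

definition mean_count :: "nat \<Rightarrow> real \<Rightarrow> (int^'n) set \<Rightarrow> (real^'n) set \<Rightarrow> real" where
  "mean_count k r Z S = (\<integral>A. real (near_count k r (cells Z) A S) \<partial>Q)"

lemma near_count_integrable:
  assumes "finite (Z :: (int^'n) set)" "loc_fin S"
  shows "integrable Q (\<lambda>A. real (near_count k r (cells Z) A S))"
  using near_count_measurable_Q[OF assms] near_count_square_integrable[OF assms]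
  by (rule square_integrable_imp_integrable)

lemma variance_le:
  assumes S: "loc_fin S"
  shows "(\<integral>A. (real (near_count k r (cells {z}) A S) - mean_count k r {z} S)\<^sup>2 \<partial>Q) \<le> cell_moment"
proof -
  let ?f = "\<lambda>A. real (near_count k r (cells {z}) A S)"
  have "variance ?f = (\<integral>A. (?f A)\<^sup>2 \<partial>Q) - (expectation ?f)\<^sup>2"
    using near_count_integrable near_count_square_integrable S by (intro variance_eq) auto
  also have "\<dots> \<le> (\<integral>A. (?f A)\<^sup>2 \<partial>Q)" by simp
  also have "\<dots> \<le> (\<integral>A. (real (card (A \<inter> cells {z})))\<^sup>2 \<partial>Q)"
    using near_count_square_integrable S near_count_square_le square_integrable[OF cells_borel bounded_cells]
    by (intro integral_mono) auto
  finally show ?thesis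
    unfolding mean_count_def integral_card_square .
qed

lemma cell_moment_nonneg: "0 \<le> cell_moment"
  unfolding cell_moment_def by simp

text \<open>Counts in far-apart cells depend on the points of \<open>A\<close> in disjoint regions.\<close>

lemma covariance_far:
  assumes S: "loc_fin S" and far: "w - z \<notin> zbox (4 * k + 2)"
  shows "(\<integral>A. (real (near_count k r (cells {z}) A S) - mean_count k r {z} S) *
    (real (near_count k r (cells {w}) A S) - mean_count k r {w} S) \<partial>Q) = 0"
proof -
  \<comment> \<open>A region made of whole cells that contains every point which can influence the
    count in cell \<open>z\<close>. Two such regions meet only if their indices differ by a
    difference of two elements of \<open>zbox (2 * k + 1)\<close>, whence 4k + 2.\<close>
  define R where "R z = cells ((+) z ` zbox (2 * k + 1))" for z :: "int^'n"
  define h where "h z A = real (near_count k r (cells {z}) A S) - mean_count k r {z} S" for z A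
  have R: "R z \<in> sets borel" for z
    unfolding R_def by (intro cells_borel) simp
  have disj: "R z \<inter> R w = {}"
  proof (rule ccontr)
    assume "R z \<inter> R w \<noteq> {}"
    then obtain x a b where "cell_index 2 x = z + a" "cell_index 2 x = w + b"
      "a \<in> zbox (2 * k + 1)" "b \<in> zbox (2 * k + 1)"
      unfolding R_def cells_def by auto
    then have wz: "w - z = a - b" "a \<in> zbox (2 * k + 1)" "b \<in> zbox (2 * k + 1)"
      by (auto simp: algebra_simps)
    have "a - b \<in> zbox (4 * k + 2)"
      unfolding zbox_def
    proof (intro CollectI allI)
      fix i
      have "- int (2 * k + 1) \<le> a $ i" "a $ i < int (2 * k + 1)" "- int (2 * k + 1) \<le> b $ i" "b $ i < int (2 * k + 1)"
        using wz(2,3) by (auto simp: zbox_def)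
      then show "- int (4 * k + 2) \<le> (a - b) $ i \<and> (a - b) $ i < int (4 * k + 2)" by auto
    qed
    with far wz(1) show False by simp
  qed
  have h_meas: "h z \<in> borel_measurable configs" for z
    unfolding h_def using near_count_measurable_fst[of "{z}" S] S by simp
  have local: "h z (A \<inter> R z) = h z A" for z A
  proof -
    have "near_count k r (cells {z}) (A \<inter> R z) S = near_count k r (cells {z}) A S"
    proof (rule near_count_local)
      fix x p assume "x \<in> cells {z}" "norm (x - p) \<le> real k"
      then have "cell_index 2 x = z" "cell_index 2 p - cell_index 2 x \<in> zbox (2 * k + 1)"
        using cell_index_near by (auto simp: cells_def)
      then show "p \<in> R z"
        unfolding R_def cells_def by (auto intro!: image_eqI[of _ _ "cell_index 2 p - z"])
    qed
    then show ?thesis by (simp add: h_def)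
  qed
  have h_int: "integrable Q (h z)" for z
    unfolding h_def using near_count_integrable[of "{z}" S] S by simp
  have h0: "(\<integral>A. h z A \<partial>Q) = 0" for z
    unfolding h_def using near_count_integrable[of "{z}" S] S by (simp add: mean_count_def prob_space)
  have "indep_var borel (h z \<circ> (\<lambda>A. A \<inter> R z)) borel (h w \<circ> (\<lambda>A. A \<inter> R w))"
    by (rule indep_var_compose[OF indep_restrict[OF R R disj] h_meas h_meas])
  then have "indep_var borel (h z) borel (h w)"
    by (simp add: comp_def local)
  from indep_var_lebesgue_integral[OF this h_int h_int] show ?thesis
    unfolding h0 by (simp add: h_def)
qed

text \<open>Expanding the square, each cell is correlated with at most as many cells as
  \<open>zbox (4 * k + 2)\<close> has elements, and each covariance is at most
  \<open>cell_moment\<close> by |ab| <= (a^2 + b^2)/2. The bound is thus linear in the number of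
  cells.\<close>

lemma count_deviation_square_le:
  assumes S: "loc_fin S"
  shows "(\<integral>A. (real (near_count k r (cells (zbox n)) A S) - mean_count k r (zbox n) S)\<^sup>2 \<partial>Q)
    \<le> real (card (zbox n :: (int^'n) set)) * (real (card (zbox (4 * k + 2) :: (int^'n) set)) * cell_moment)"
proof -
  define h where "h z A = real (near_count k r (cells {z}) A S) - mean_count k r {z} S" for z A
  have int: "integrable Q (\<lambda>A. real (near_count k r (cells {z}) A S))" for z
    using near_count_integrable[of "{z}" S] S by simp
  have h_meas [measurable]: "h z \<in> borel_measurable Q" for z
    unfolding h_def using near_count_measurable_Q[of "{z}" S] S by simp
  have h2_int: "integrable Q (\<lambda>A. (h z A)\<^sup>2)" for z
  proof -
    have "integrable Q (\<lambda>A. (real (near_count k r (cells {z}) A S))\<^sup>2)"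
      using near_count_square_integrable[of "{z}" S] S by simp
    then show ?thesis
      unfolding h_def power2_diff using int by simp
  qed
  have abs_mult: "\<bar>h z A * h w A\<bar> \<le> ((h z A)\<^sup>2 + (h w A)\<^sup>2) / 2" for z w A
    using zero_le_power2[of "\<bar>h z A\<bar> - \<bar>h w A\<bar>"] by (simp add: power2_diff abs_mult)
  have hh_int: "integrable Q (\<lambda>A. h z A * h w A)" for z w
  proof (rule Bochner_Integration.integrable_bound)
    show "integrable Q (\<lambda>A. ((h z A)\<^sup>2 + (h w A)\<^sup>2) / 2)"
      using h2_int by simp
  qed (use abs_mult in auto)
  have sum_h: "real (near_count k r (cells (zbox n)) A S) - mean_count k r (zbox n) S = (\<Sum>z\<in>zbox n. h z A)"
    if "A \<in> space Q" for A
  proof -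
    have "mean_count k r (zbox n) S = (\<integral>A. (\<Sum>z\<in>zbox n. real (near_count k r (cells {z}) A S)) \<partial>Q)"
      unfolding mean_count_def
      by (intro Bochner_Integration.integral_cong) (simp_all add: near_count_cells[of _ "zbox n"] space_Q)
    then have "mean_count k r (zbox n) S = (\<Sum>z\<in>zbox n. mean_count k r {z} S)"
      using int by (simp add: mean_count_def)
    then show ?thesis
      using that by (simp add: h_def near_count_cells[of _ "zbox n"] space_Q sum_subtractf)
  qed
  have cov: "(\<integral>A. h z A * h w A \<partial>Q) \<le> cell_moment" for z w
  proof -
    have "(\<integral>A. h z A * h w A \<partial>Q) \<le> (\<integral>A. ((h z A)\<^sup>2 + (h w A)\<^sup>2) / 2 \<partial>Q)"
      by (intro integral_mono order_trans[OF abs_ge_self abs_mult]) (use hh_int h2_int in simp_all)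
    also have "\<dots> = ((\<integral>A. (h z A)\<^sup>2 \<partial>Q) + (\<integral>A. (h w A)\<^sup>2 \<partial>Q)) / 2"
      using h2_int by simp
    also have "\<dots> \<le> cell_moment"
      using variance_le[OF S, of k r z] variance_le[OF S, of k r w] by (simp add: h_def)
    finally show ?thesis .
  qed
  have "(\<integral>A. (real (near_count k r (cells (zbox n)) A S) - mean_count k r (zbox n) S)\<^sup>2 \<partial>Q)
      = (\<integral>A. (\<Sum>z\<in>zbox n. \<Sum>w\<in>zbox n. h z A * h w A) \<partial>Q)"
    by (intro Bochner_Integration.integral_cong) (auto simp: sum_h power2_eq_square sum_product)
  also have "\<dots> = (\<Sum>z\<in>zbox n. \<Sum>w\<in>zbox n. \<integral>A. h z A * h w A \<partial>Q)"
    using hh_int by simp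
  also have "\<dots> \<le> (\<Sum>z\<in>(zbox n :: (int^'n) set). real (card (zbox (4 * k + 2) :: (int^'n) set)) * cell_moment)"
  proof (rule sum_mono)
    fix z :: "int^'n"
    let ?N = "(+) z ` zbox (4 * k + 2)"
    have "(\<Sum>w\<in>zbox n. \<integral>A. h z A * h w A \<partial>Q) = (\<Sum>w\<in>zbox n \<inter> ?N. \<integral>A. h z A * h w A \<partial>Q)"
    proof (rule sum.mono_neutral_right)
      show "\<forall>w\<in>zbox n - zbox n \<inter> ?N. (\<integral>A. h z A * h w A \<partial>Q) = 0"
      proof
        fix w assume "w \<in> zbox n - zbox n \<inter> ?N"
        then have "w - z \<notin> zbox (4 * k + 2)"
          by (auto simp: image_iff algebra_simps)
        then show "(\<integral>A. h z A * h w A \<partial>Q) = 0"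
          unfolding h_def by (rule covariance_far[OF S])
      qed
    qed auto
    also have "\<dots> \<le> (\<Sum>w\<in>zbox n \<inter> ?N. cell_moment)"
      by (intro sum_mono cov)
    also have "\<dots> \<le> (\<Sum>w\<in>?N. cell_moment)"
      using cell_moment_nonneg by (intro sum_mono2) auto
    finally show "(\<Sum>w\<in>zbox n. \<integral>A. h z A * h w A \<partial>Q) \<le> real (card (zbox (4 * k + 2) :: (int^'n) set)) * cell_moment"
      by (simp add: card_image)
  qed
  finally show ?thesis by simp
qed

text \<open>The series of squared normalised deviations has finite expectation, so it converges
  almost surely and its terms vanish. Working along all n at once requires the variances, of order
  n^-d, to be summable.\<close>

lemma count_law_of_large_numbers:
  assumes S: "loc_fin S" and d: "2 \<le> CARD('n)"
  shows "AE A in Q. (\<lambda>n. (real (near_count k r (cells (zbox n)) A S) - mean_count k r (zbox n) S)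
    / real (card (zbox n :: (int^'n) set))) \<longlonglongrightarrow> 0"
proof -
  let ?c = "\<lambda>n. real (card (zbox n :: (int^'n) set))"
  define D where "D n A = (real (near_count k r (cells (zbox n)) A S) - mean_count k r (zbox n) S) / ?c n" for n A
  define C where "C = real (card (zbox (4 * k + 2) :: (int^'n) set)) * cell_moment"
  have C: "0 \<le> C" unfolding C_def using cell_moment_nonneg by simp
  have [measurable]: "D n \<in> borel_measurable Q" for n
    unfolding D_def using near_count_measurable_Q[of "zbox n" S] S by simp
  have D2_int: "integrable Q (\<lambda>A. (D n A)\<^sup>2)" for n
    unfolding D_def power_divide power2_diff
    using near_count_square_integrable[of "zbox n" S] near_count_integrable[of "zbox n" S] S by simp
  have D2: "(\<integral>A. (D n A)\<^sup>2 \<partial>Q) \<le> C * inverse (real n ^ 2)" if n: "0 < n" for n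
  proof -
    have c: "0 < ?c n" using n by (simp add: card_zbox)
    have "(\<integral>A. (D n A)\<^sup>2 \<partial>Q) = (\<integral>A. (real (near_count k r (cells (zbox n)) A S) - mean_count k r (zbox n) S)\<^sup>2 \<partial>Q) / (?c n)\<^sup>2"
      unfolding D_def power_divide by simp
    also have "\<dots> \<le> ?c n * C / (?c n)\<^sup>2"
      unfolding C_def by (intro divide_right_mono count_deviation_square_le S) simp
    also have "\<dots> = C * inverse (?c n)"
      using c by (simp add: power2_eq_square field_simps)
    also have "\<dots> \<le> C * inverse (real n ^ 2)"
    proof (intro mult_left_mono le_imp_inverse_le C)
      have "real n ^ 2 \<le> real (2 * n) ^ 2"
        by (intro power_mono) auto
      also have "\<dots> \<le> real (2 * n) ^ CARD('n)"
        using n d by (intro power_increasing) auto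
      finally show "real n ^ 2 \<le> ?c n" by (simp add: card_zbox)
    qed (use n in auto)
    finally show ?thesis .
  qed
  have "(\<integral>\<^sup>+A. (\<Sum>n. ennreal ((D (Suc n) A)\<^sup>2)) \<partial>Q) = (\<Sum>n. \<integral>\<^sup>+A. ennreal ((D (Suc n) A)\<^sup>2) \<partial>Q)"
    by (rule nn_integral_suminf) measurable
  also have "\<dots> = (\<Sum>n. ennreal (\<integral>A. (D (Suc n) A)\<^sup>2 \<partial>Q))"
    using D2_int by (intro suminf_cong nn_integral_eq_integral) auto
  also have "\<dots> \<le> (\<Sum>n. ennreal (C * inverse (real (Suc n) ^ 2)))"
    by (intro suminf_le ennreal_leI D2) auto
  also have "\<dots> < \<infinity>"
  proof -
    have "summable (\<lambda>n. inverse (real n ^ 2))"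
      by (rule inverse_power_summable) simp
    then have "summable (\<lambda>n. C * inverse (real (Suc n) ^ 2))"
      by (subst (asm) summable_Suc_iff[symmetric]) (rule summable_mult)
    then show ?thesis
      using C by (simp add: suminf_ennreal2 less_top del: of_nat_Suc)
  qed
  finally have "AE A in Q. (\<Sum>n. ennreal ((D (Suc n) A)\<^sup>2)) \<noteq> \<infinity>"
    by (intro nn_integral_PInf_AE) auto
  then show ?thesis
  proof eventually_elim
    case (elim A)
    then have "summable (\<lambda>n. (D (Suc n) A)\<^sup>2)"
      by (intro summable_suminf_not_top) (auto simp: less_top)
    then have "(\<lambda>n. (D (Suc n) A)\<^sup>2) \<longlonglongrightarrow> 0"
      by (rule summable_LIMSEQ_zero)
    then have "(\<lambda>n. sqrt ((D (Suc n) A)\<^sup>2)) \<longlonglongrightarrow> sqrt 0"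
      by (rule tendsto_real_sqrt)
    then have "(\<lambda>n. D (Suc n) A) \<longlonglongrightarrow> 0"
      by (simp add: tendsto_rabs_zero_iff)
    then show ?case
      unfolding D_def by (rule LIMSEQ_imp_Suc)
  qed
qed

end

subsection \<open>Convergence of the mean hop count\<close>

lemma translate_translate: "(+) u ` (+) v ` S = (+) (u + v) ` S" for u v :: "real^'n"
  by (auto simp: image_iff add.assoc)

lemma cells_mono: "Y \<subseteq> Z \<Longrightarrow> cells Y \<subseteq> cells Z"
  unfolding cells_def by blast

section \<open>Expected counts as functions of the second configuration\<close>

context poisson_law
begin

lemma integrable_near_count:
  assumes "B \<in> sets borel" "bounded B" "loc_fin S"
  shows "integrable Q (\<lambda>A. real (near_count k r B A S))"
proof (rule Bochner_Integration.integrable_bound)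
  show "integrable Q (\<lambda>A. real (card (A \<inter> B)))"
    using card_measurable_Q[OF assms(1,2)] square_integrable[OF assms(1,2)]
    by (rule square_integrable_imp_integrable)
  show "(\<lambda>A. real (near_count k r B A S)) \<in> borel_measurable Q"
    using near_count_measurable_left[OF assms] by (simp add: measurable_cong_sets[OF sets_Q refl])
  show "AE A in Q. norm (real (near_count k r B A S)) \<le> norm (real (card (A \<inter> B)))"
    using near_count_le_card[OF _ assms(2)] by (intro AE_I2) (simp add: space_Q)
qed

lemma integral_near_count_translate:
  assumes B: "B \<in> sets borel" "bounded B" and S: "loc_fin S" and r: "r \<noteq> 0"
  shows "(\<integral>A. real (near_count k r B A ((+) v ` S)) \<partial>Q) = (\<integral>A. real (near_count k r {x. r *\<^sub>R v + x \<in> B} A S) \<partial>Q)"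
  using integral_translate[OF near_count_measurable_left[OF B loc_fin_translate[OF S, of v]], of k r "r *\<^sub>R v"]
  by (simp add: near_count_translate[OF r])

lemma mean_count_le:
  assumes "loc_fin S"
  shows "mean_count k r {z} S \<le> cell_moment"
proof -
  have int: "integrable Q (\<lambda>A. real (near_count k r (cells {z}) A S))"
    "integrable Q (\<lambda>A. (real (card (A \<inter> cells {z})))\<^sup>2)"
    using near_count_integrable[of "{z}" S] assms square_integrable[OF cells_borel bounded_cells, of "{z}"] by simp_all
  have "real m \<le> (real m)\<^sup>2" for m :: nat
    unfolding power2_eq_square of_nat_mult[symmetric] of_nat_le_iff by (rule le_square)
  then have "real (near_count k r (cells {z}) A S) \<le> (real (card (A \<inter> cells {z})))\<^sup>2" if "A \<in> space Q" for A
    using near_count_square_le[OF that, of "{z}" k r S] by (meson finite.emptyI finite.insertI order_trans)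
  then have "mean_count k r {z} S \<le> (\<integral>A. (real (card (A \<inter> cells {z})))\<^sup>2 \<partial>Q)"
    unfolding mean_count_def using int by (intro integral_mono) auto
  then show ?thesis unfolding integral_card_square .
qed

lemma mean_count_nonneg: "0 \<le> mean_count k r Z S"
  unfolding mean_count_def by simp

lemma mean_count_sum:
  assumes "finite (Z :: (int^'n) set)" "loc_fin S"
  shows "mean_count k r Z S = (\<Sum>z\<in>Z. mean_count k r {z} S)"
proof -
  have "mean_count k r Z S = (\<integral>A. (\<Sum>z\<in>Z. real (near_count k r (cells {z}) A S)) \<partial>Q)"
    unfolding mean_count_def
    by (intro Bochner_Integration.integral_cong) (simp_all add: near_count_cells[OF _ assms(1)] space_Q)
  then show ?thesis
    using near_count_integrable[OF _ assms(2)] by (simp add: mean_count_def)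
qed

lemma mean_count_measurable:
  assumes Z: "finite (Z :: (int^'n) set)"
  shows "mean_count k r Z \<in> borel_measurable configs"
proof -
  have "(\<lambda>p. (snd p, fst p)) \<in> measurable (configs \<Otimes>\<^sub>M Q) (configs \<Otimes>\<^sub>M configs)"
    by measurable
  from measurable_compose[OF this near_count_measurable[OF cells_borel[OF Z] bounded_cells[OF Z], of k r]]
  have "(\<lambda>(S, A). real (near_count k r (cells Z) A S)) \<in> borel_measurable (configs \<Otimes>\<^sub>M Q)"
    by (simp add: case_prod_beta)
  then show ?thesis
    unfolding mean_count_def by (rule borel_measurable_lebesgue_integral)
qed

text \<open>Shifting \<open>S\<close> by -z/(2r) shifts the targets by -z/2, that is, by
  \<open>z\<close> cells; stationarity of \<open>Q\<close> absorbs the accompanying shift of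
  \<open>A\<close>. This expresses the counts in all cells as one function evaluated along a lattice
  orbit of \<open>S\<close>.\<close>

lemma mean_count_shift_cell:
  assumes S: "loc_fin S" and r: "0 < r"
  shows "mean_count k r {w} ((+) (\<chi> i. - of_int (z $ i) / (2 * r)) ` S) = mean_count k r {z + w} S"
proof -
  let ?v = "(\<chi> i. - of_int (z $ i) / (2 * r)) :: real^'n"
  have eq: "cell_index 2 (r *\<^sub>R ?v + x) = - z + cell_index 2 x" for x
    by (rule cell_index_translate) (use r in simp)
  have "cell_index 2 (r *\<^sub>R ?v + x) = w \<longleftrightarrow> cell_index 2 x = z + w" for x
    unfolding eq by (auto simp: algebra_simps)
  then have "{x. r *\<^sub>R ?v + x \<in> cells {w}} = cells {z + w}"
    unfolding cells_def by simp
  then show ?thesis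
    unfolding mean_count_def
    using integral_near_count_translate[OF cells_borel bounded_cells S, of "{w}" r k ?v] r by simp
qed

text \<open>Covers arbitrary real shifts, which do not map cells to cells. Both counts lie between
  those over \<open>zbox (n - L)\<close> and \<open>zbox (n + L)\<close>, so they differ by at most
  the expected count in the shell. This is the source of invariance under real translations.\<close>

lemma mean_count_shift_close:
  assumes S: "loc_fin S" and r: "0 < r" and L: "\<And>i. 2 * r * \<bar>v $ i\<bar> + 1 \<le> real L"
  shows "\<bar>mean_count k r (zbox n) ((+) v ` S) - mean_count k r (zbox n) S\<bar> \<le> cell_moment * real (card (shell L n :: (int^'n) set))"
proof -
  let ?B = "{x. r *\<^sub>R v + x \<in> cells (zbox n)}"
  \<comment> \<open>Adding t to a number changes its floor by less than |t| + 1; this explains the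
    extra 1 in the condition on \<open>L\<close>.\<close>
  have near: "\<bar>(cell_index 2 (r *\<^sub>R v + x) - cell_index 2 x) $ i\<bar> \<le> int L" for x i
  proof -
    have "\<bar>2 * (r * v $ i)\<bar> + 1 \<le> real L"
      using L[of i] r by (simp add: abs_mult)
    then have "\<bar>\<lfloor>2 * (r * v $ i) + 2 * x $ i\<rfloor> - \<lfloor>2 * x $ i\<rfloor>\<bar> \<le> int L" by linarith
    then show ?thesis by (simp add: cell_index_def distrib_left)
  qed
  have B: "?B \<in> sets borel" "bounded ?B"
    by (rule borel_translate[OF cells_borel[OF finite_zbox]])
      (rule bounded_translate_vimage[OF bounded_cells[OF finite_zbox]])
  have sub1: "cells (zbox (n - L)) \<subseteq> ?B"
  proof
    fix x assume x: "x \<in> cells (zbox (n - L) :: (int^'n) set)"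
    then have L_le: "L \<le> n"
      by (cases "L \<le> n") (auto simp: cells_def zbox_def)
    have "cell_index 2 (r *\<^sub>R v + x) - cell_index 2 x + cell_index 2 x \<in> zbox (n - L + L)"
      using x by (intro zbox_add near) (simp add: cells_def)
    then show "x \<in> ?B" using L_le by (simp add: cells_def)
  qed
  have sub2: "?B \<subseteq> cells (zbox (n + L))"
  proof
    fix x assume "x \<in> ?B"
    then have "- (cell_index 2 (r *\<^sub>R v + x) - cell_index 2 x) + cell_index 2 (r *\<^sub>R v + x) \<in> zbox (n + L)"
      using near[of x] by (intro zbox_add) (simp_all add: cells_def abs_minus_commute)
    then show "x \<in> cells (zbox (n + L))" by (simp add: cells_def)
  qed
  define G where "G B = (\<integral>A. real (near_count k r B A S) \<partial>Q)" for B
  have mono: "G B \<le> G C" if "B \<subseteq> C" "B \<in> sets borel" "C \<in> sets borel" "bounded C" for B C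
    unfolding G_def
    using that bounded_subset[OF that(4,1)] near_count_mono[OF _ that(4), of _ B k r S] S
    by (intro integral_mono integrable_near_count) (auto simp: space_Q)
  have Gm: "G (cells Z) = mean_count k r Z S" for Z
    by (simp add: G_def mean_count_def)
  have "mean_count k r (zbox n) ((+) v ` S) = G ?B"
    unfolding G_def mean_count_def using r S by (intro integral_near_count_translate cells_borel bounded_cells) auto
  moreover have "G (cells (zbox (n - L))) \<le> G ?B" "G ?B \<le> G (cells (zbox (n + L)))"
    using sub1 sub2 B by (auto intro!: mono cells_borel bounded_cells)
  moreover have "G (cells (zbox (n - L))) \<le> G (cells (zbox n))" "G (cells (zbox n)) \<le> G (cells (zbox (n + L)))"
    by (intro mono cells_borel bounded_cells finite_zbox cells_mono zbox_mono; simp)+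
  moreover have "G (cells (zbox (n + L))) - G (cells (zbox (n - L))) \<le> cell_moment * real (card (shell L n :: (int^'n) set))"
  proof -
    have "G (cells (zbox (n + L))) - G (cells (zbox (n - L))) = (\<Sum>z\<in>shell L n. mean_count k r {z} S)"
      unfolding Gm mean_count_sum[OF finite_zbox S] shell_def
      using zbox_mono[OF order_trans[OF diff_le_self le_add1], of n L L] by (subst sum_diff) auto
    also have "\<dots> \<le> (\<Sum>z\<in>(shell L n :: (int^'n) set). cell_moment)"
      by (intro sum_mono mean_count_le S)
    finally show ?thesis by (simp add: mult.commute)
  qed
  ultimately show ?thesis
    unfolding Gm[symmetric] by linarith
qed

text \<open>The averages of the bounded function \<open>mean_count k r {0}\<close> along the lattice
  are the normalised expected counts. Subsequential limits are invariant under real translations, so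
  the zero-one law for \<open>R\<close> supplies the constancy that \<open>pointwise_ergodic\<close>
  asks for.\<close>

lemma mean_count_ergodic:
  fixes R :: "(real^'n) set measure"
  assumes "prob_space R" and sets_R [measurable_cong]: "sets R = sets configs"
    and stat: "\<And>v. distr R configs (\<lambda>S. (+) v ` S) = R"
    and erg: "\<And>E. E \<in> sets configs \<Longrightarrow> shift_invariant E \<Longrightarrow> measure R E \<in> {0, 1}"
    and r: "0 < r"
  shows "AE S in R. (\<lambda>n. mean_count k r (zbox n) S / real (card (zbox n :: (int^'n) set)))
    \<longlonglongrightarrow> (\<integral>S. mean_count k r {0} S \<partial>R)"
proof -
  interpret R: prob_space R by fact
  define T where "T z S = (+) (\<chi> i. - of_int (z $ i) / (2 * r)) ` S" for z :: "int^'n" and S :: "(real^'n) set"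
  have space_R: "space R = Collect loc_fin"
    using sets_eq_imp_space_eq[OF sets_R] by (simp add: space_configs)
  interpret R: lattice_action R T
  proof unfold_locales
    fix z w :: "int^'n"
    show "T z \<in> measurable R R"
      using translate_measurable unfolding T_def by (simp add: measurable_cong_sets[OF sets_R sets_R])
    have "distr R R (T z) = distr R configs (T z)"
      by (rule distr_cong) (simp_all add: sets_R)
    then show "distr R R (T z) = R"
      unfolding T_def using stat by simp
    fix S
    have "(\<chi> i. - of_int (z $ i) / (2 * r)) + (\<chi> i. - of_int (w $ i) / (2 * r)) = ((\<chi> i. - of_int ((z + w) $ i) / (2 * r)) :: real^'n)"
      by (simp add: vec_eq_iff diff_divide_distrib)
    then show "T z (T w S) = T (z + w) S"
      unfolding T_def by (simp add: translate_translate)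
  qed
  let ?F = "mean_count k r {0}"
  have F_meas [measurable]: "?F \<in> borel_measurable configs"
    by (rule mean_count_measurable) simp
  have F_bd: "\<forall>S\<in>space R. \<bar>?F S\<bar> \<le> cell_moment"
    using mean_count_le mean_count_nonneg by (auto simp: space_R)
  have avg_eq: "R.avg n ?F S = mean_count k r (zbox n) S / real (card (zbox n :: (int^'n) set))"
    if "loc_fin S" for n S
    unfolding R.avg_def mean_count_sum[OF finite_zbox that] T_def
    using mean_count_shift_cell[OF that r, of k 0] by simp
  have avg_meas [measurable]: "R.avg n ?F \<in> borel_measurable configs" for n
    using R.avg_measurable[of ?F n] by (simp add: measurable_cong_sets[OF sets_R refl])
  have shift: "(\<lambda>n. R.avg n ?F ((+) v ` S) - R.avg n ?F S) \<longlonglongrightarrow> 0" if S: "loc_fin S" for v S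
  proof -
    obtain L :: nat where "2 * r * norm v + 1 \<le> real L"
      using real_arch_simple by blast
    then have L: "2 * r * \<bar>v $ i\<bar> + 1 \<le> real L" for i
      using mult_left_mono[OF component_le_norm_cart[of v i], of "2 * r"] r by linarith
    have "norm (R.avg n ?F ((+) v ` S) - R.avg n ?F S) \<le> R.translation_error cell_moment L n" for n
      unfolding avg_eq[OF S] avg_eq[OF loc_fin_translate[OF S]] R.translation_error_def
      using divide_right_mono[OF mean_count_shift_close[OF S r L, of k n], of "real (card (zbox n :: (int^'n) set))"]
      by (simp add: abs_divide flip: diff_divide_distrib)
    then show ?thesis
      by (intro Lim_null_comparison[OF _ R.translation_error_tendsto[of cell_moment L]] always_eventually) blast
  qed
  have "AE S in R. (\<lambda>n. R.avg n ?F S) \<longlonglongrightarrow> (\<integral>S. ?F S \<partial>R)"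
  proof (rule R.pointwise_ergodic[OF _ F_bd])
    show "?F \<in> borel_measurable R" by measurable
    fix s :: "nat \<Rightarrow> nat"
    assume s: "strict_mono s" and conv: "AE S in R. convergent (\<lambda>j. R.avg (s j) ?F S)"
    define l where "l S = lim (\<lambda>j. R.avg (s j) ?F S)" for S
    have l_meas [measurable]: "l \<in> borel_measurable configs"
      unfolding l_def by measurable
    have conv_shift: "convergent (\<lambda>j. R.avg (s j) ?F ((+) v ` S)) \<and> l ((+) v ` S) = l S"
      if "loc_fin S" "convergent (\<lambda>j. R.avg (s j) ?F S)" for v S
    proof -
      have "(\<lambda>j. R.avg (s j) ?F S + (R.avg (s j) ?F ((+) v ` S) - R.avg (s j) ?F S)) \<longlonglongrightarrow> l S + 0"
        using LIMSEQ_subseq_LIMSEQ[OF shift[OF that(1), of v] s] that(2) unfolding l_def comp_def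
        by (intro tendsto_add) (simp_all add: convergent_LIMSEQ_iff)
      then have "(\<lambda>j. R.avg (s j) ?F ((+) v ` S)) \<longlonglongrightarrow> l S" by simp
      then show ?thesis
        unfolding l_def[of "(+) v ` S"] by (auto simp: convergent_def limI)
    qed
    \<comment> \<open>Invariance is required at every configuration, not just almost everywhere. The
      event is confined to configurations where \<open>l\<close> is a genuine limit, and the shift
      by \<open>- v\<close> carries convergence back from the translate.\<close>
    have inv: "shift_invariant {S \<in> space configs. convergent (\<lambda>j. R.avg (s j) ?F S) \<and> P (l S)}" for P
      unfolding shift_invariant_def
    proof (intro allI ballI)
      fix v and S :: "(real^'n) set" assume "S \<in> space configs"
      then have S: "loc_fin S" "loc_fin ((+) v ` S)"
        by (auto simp: space_configs loc_fin_translate)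
      have undo: "(+) (- v) ` (+) v ` S = S"
        unfolding translate_translate by simp
      show "(+) v ` S \<in> {S \<in> space configs. convergent (\<lambda>j. R.avg (s j) ?F S) \<and> P (l S)}
          \<longleftrightarrow> S \<in> {S \<in> space configs. convergent (\<lambda>j. R.avg (s j) ?F S) \<and> P (l S)}"
        using conv_shift[OF S(1), of v] conv_shift[OF S(2), of "- v"] S unfolding undo
        by (auto simp: space_configs)
    qed
    define c where "c = (\<integral>S. l S \<partial>R)"
    have l_int: "integrable R l"
    proof (rule R.integrable_const_bound[where B = cell_moment])
      show "AE S in R. norm (l S) \<le> cell_moment"
        using conv AE_space
      proof eventually_elim
        case (elim S)
        then have lim: "(\<lambda>j. R.avg (s j) ?F S) \<longlonglongrightarrow> l S"
          by (simp add: l_def convergent_LIMSEQ_iff)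
        show ?case
          using R.avg_bounded[OF F_bd] elim(2)
          by (intro Lim_bounded[OF tendsto_norm[OF lim], of 0]) auto
      qed
    qed measurable
    \<comment> \<open>The zero-one law in the form used twice below: an event expressed through
      \<open>l\<close> that fails to be almost sure is null.\<close>
    have null: "AE S in R. \<not> P (l S)"
      if meas: "{S \<in> space configs. P (l S)} \<in> sets configs"
        and neq: "\<not> (AE S in R. P (l S))" for P
    proof -
      let ?E = "{S \<in> space configs. convergent (\<lambda>j. R.avg (s j) ?F S) \<and> P (l S)}"
      have "?E = {S \<in> space configs. convergent (\<lambda>j. R.avg (s j) ?F S)} \<inter> {S \<in> space configs. P (l S)}"
        by auto
      moreover have "{S \<in> space configs. convergent (\<lambda>j. R.avg (s j) ?F S)} \<in> sets configs"
        using sets_Collect_Cauchy[of "\<lambda>j. R.avg (s j) ?F" configs] by (simp add: Cauchy_convergent_iff)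
      ultimately have E: "?E \<in> sets configs"
        using meas by auto
      have "R.prob ?E \<noteq> 1"
      proof
        assume "R.prob ?E = 1"
        then have "AE S in R. S \<in> ?E"
          using E by (subst R.AE_in_set_eq_1) (simp_all add: sets_R)
        then have "AE S in R. P (l S)" by eventually_elim simp
        with neq show False by simp
      qed
      with erg[OF E inv] have "R.prob ?E = 0" by blast
      then have "AE S in R. S \<notin> ?E"
        using E by (simp only: R.prob_eq_0 sets_R)
      then show ?thesis
        using conv AE_space by eventually_elim (auto simp: space_R space_configs)
    qed
    \<comment> \<open>A random variable is not almost surely strictly on one side of its own mean.
      By the zero-one law both strict inequalities are then null, so \<open>l\<close> equals its
      mean.\<close>
    have "\<not> (AE S in R. l S < c)" "\<not> (AE S in R. c < l S)"
      using R.expectation_less[OF l_int, of c] R.expectation_greater[OF l_int, of c] by (auto simp: c_def)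
    then have "AE S in R. \<not> l S < c" "AE S in R. \<not> c < l S"
      by (intro null; simp)+
    then have "AE S in R. (\<lambda>j. R.avg (s j) ?F S) \<longlonglongrightarrow> c"
      using conv
    proof eventually_elim
      case (elim S)
      then have "l S = c" by simp
      then show ?case
        using elim(3) by (auto simp: l_def convergent_LIMSEQ_iff)
    qed
    then show "\<exists>c. AE S in R. (\<lambda>j. R.avg (s j) ?F S) \<longlonglongrightarrow> c" by blast
  qed
  then show ?thesis
    using AE_space by eventually_elim (simp add: avg_eq space_R)
qed

end

subsection \<open>The limit of the hop count\<close>

lemma cells_zbox_subset_cube: "cells (zbox n :: (int^'n) set) \<subseteq> cube (real n)"
proof
  fix x assume "x \<in> cells (zbox n :: (int^'n) set)"
  then have "- int n \<le> \<lfloor>2 * x $ i\<rfloor>" "\<lfloor>2 * x $ i\<rfloor> < int n" for i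
    by (auto simp: cells_def zbox_def cell_index_def)
  then have "- real n / 2 \<le> x $ i \<and> x $ i \<le> real n / 2" for i
    using le_floor_iff[of "- int n" "2 * x $ i"] floor_less_iff[of "2 * x $ i" "int n"] by force
  then show "x \<in> cube (real n)"
    by (simp add: cube_def mem_box_cart)
qed

text \<open>The cube is closed and the cells are half-open, so the difference lies in the boundary
  of the cube.\<close>

lemma cube_diff_cells_null: "cube (real n) - cells (zbox n) \<in> null_sets (lborel :: (real^'n) measure)"
proof -
  let ?a = "vec (- real n / 2) :: real^'n" and ?b = "vec (real n / 2) :: real^'n"
  have "box ?a ?b \<subseteq> cells (zbox n)"
  proof
    fix x assume "x \<in> box ?a ?b"
    then have "- real n < 2 * x $ i" "2 * x $ i < real n" for i
      by (simp_all add: mem_box_cart field_simps)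
    then have "- int n \<le> \<lfloor>2 * x $ i\<rfloor> \<and> \<lfloor>2 * x $ i\<rfloor> < int n" for i
      using le_floor_iff[of "- int n" "2 * x $ i"] floor_less_iff[of "2 * x $ i" "int n"] by (simp add: less_imp_le)
    then show "x \<in> cells (zbox n)"
      by (simp add: cells_def zbox_def cell_index_def)
  qed
  then have sub: "cube (real n) - cells (zbox n) \<subseteq> cbox ?a ?b - box ?a ?b"
    unfolding cube_def by auto
  have "emeasure lborel (cbox ?a ?b - box ?a ?b) = emeasure lborel (cbox ?a ?b) - emeasure lborel (box ?a ?b)"
    by (rule emeasure_Diff) (use emeasure_lborel_box_finite[of ?a ?b] box_subset_cbox[of ?a ?b] in \<open>auto simp: less_top\<close>)
  also have "\<dots> = 0"
    by (simp add: emeasure_lborel_cbox_eq emeasure_lborel_box_eq)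
  finally have "cbox ?a ?b - box ?a ?b \<in> null_sets lborel"
    by (intro null_setsI) auto
  then show ?thesis
    by (rule null_sets_subset[OF _ _ sub]) (simp add: cube_def cells_borel sets.Diff)
qed

lemma cube_borel: "cube s \<in> sets borel" and bounded_cube: "bounded (cube s)"
  by (simp_all add: cube_def bounded_cbox)

context poisson_law
begin

text \<open>The exceptional set consists of those \<open>A\<close> with a point on the boundary of
  some cube. It does not depend on \<open>S\<close>, so the quantifier over \<open>S\<close> can
  stand inside the almost sure statement.\<close>

lemma AE_near_count_cube:
  "AE A in Q. \<forall>n S. near_count k r (cube (real n)) A S = near_count k r (cells (zbox n)) A S"
proof -
  have "AE A in Q. A \<inter> (cube (real n) - cells (zbox n)) = {}" for n
  proof -
    let ?D = "cube (real n) - cells (zbox n) :: (real^'n) set"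
    have D: "?D \<in> sets borel" "bounded ?D" "measure lborel ?D = 0"
      using cube_diff_cells_null[where ?'n = 'n, of n] bounded_cube[of "real n"]
      by (auto simp: cube_borel cells_borel measure_def null_setsD1 intro: bounded_subset)
    have "{A. loc_fin A \<and> A \<inter> ?D = {}} \<in> sets Q"
      unfolding sets_Q sets_configs_void void_events_def using D by (intro sigma_sets.Basic) blast
    moreover have "prob {A. loc_fin A \<and> A \<inter> ?D = {}} = 1"
      using void_prob[OF D(1,2)] D(3) by simp
    ultimately have "AE A in Q. A \<in> {A. loc_fin A \<and> A \<inter> ?D = {}}"
      by (simp only: AE_in_set_eq_1)
    then show ?thesis by eventually_elim simp
  qed
  then have "AE A in Q. \<forall>n. A \<inter> (cube (real n) - cells (zbox n)) = {}"
    by (intro AE_all_countable[THEN iffD2] allI)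
  then show ?thesis
  proof eventually_elim
    case (elim A)
    have "A \<inter> cube (real n) = A \<inter> cells (zbox n)" for n
      using elim cells_zbox_subset_cube by blast
    then show ?case by (simp add: near_count_def)
  qed
qed

end

theorem proposition1:
  fixes M :: "'w measure"
    and X Y1 :: "'w \<Rightarrow> (real^'n) set"
    and lambda lambda' r :: real
    and k :: nat
  assumes "prob_space M"
    and "CARD('n) \<ge> 2"
    and "lambda > 0"
    and "poisson_process M lambda X"
    and "point_process M Y1"
    and "stationary M Y1"
    and "ergodic M Y1"
    and "lambda' > 0"
    and "intensity M Y1 = ennreal lambda'"
    and "prob_space.indep_var M configs X configs Y1"
    and "k \<ge> 1"
    and "r > 0"
  shows "AE \<omega> in M.
    (\<lambda>n::nat. inverse lambda * inverse (real n ^ CARD('n)) *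
        real (hop_count (X \<omega>) (Y1 \<omega>) k r (real n)))
      \<longlonglongrightarrow> Theta M lambda X Y1 k r"
proof -
  interpret prob_space M by fact
  let ?Q = "distr M configs X" and ?R = "distr M configs Y1"
  let ?d = "CARD('n)"
  have X [measurable]: "X \<in> measurable M configs"
    using assms(4) unfolding poisson_process_def point_process_def by blast
  have Y [measurable]: "Y1 \<in> measurable M configs"
    using assms(5) unfolding point_process_def by blast
  interpret Q: poisson_law ?Q lambda
    by (rule poisson_process_law) fact+
  interpret R: prob_space ?R
    by (rule prob_space_distr[OF Y])
  interpret QR: pair_prob_space ?Q ?R ..
  have joint: "distr M (configs \<Otimes>\<^sub>M configs) (\<lambda>\<omega>. (X \<omega>, Y1 \<omega>)) = ?Q \<Otimes>\<^sub>M ?R"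
    using assms(10) by (simp add: indep_var_distribution_eq)
  let ?N = "\<lambda>n A S. real (near_count k r (cube (real n)) A S)"
  have N_meas [measurable]: "(\<lambda>(A, S). ?N n A S) \<in> borel_measurable (configs \<Otimes>\<^sub>M configs)" for n
    by (rule near_count_measurable[OF cube_borel bounded_cube])
  define L where "L = (\<integral>S. Q.mean_count k r {0} S \<partial>?R)"
  have N_eq_cells: "(\<integral>A. ?N n A S \<partial>?Q) = Q.mean_count k r (zbox n) S" if "loc_fin S" for n S
    unfolding Q.mean_count_def
  proof (rule integral_cong_AE)
    show "(\<lambda>A. ?N n A S) \<in> borel_measurable ?Q"
      using near_count_measurable_left[OF cube_borel bounded_cube that] by simp
    show "(\<lambda>A. real (near_count k r (cells (zbox n)) A S)) \<in> borel_measurable ?Q"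
      using Q.near_count_measurable_Q[OF finite_zbox that] .
    show "AE A in ?Q. ?N n A S = real (near_count k r (cells (zbox n)) A S)"
      using Q.AE_near_count_cube[of k r] by eventually_elim simp
  qed
  have stat: "distr ?R configs (\<lambda>S. (+) v ` S) = ?R" for v
    using assms(6) distr_distr[OF translate_measurable Y] unfolding stationary_def by (simp add: comp_def)
  have mean_meas [measurable]: "Q.mean_count k r Z \<in> borel_measurable configs" if "finite Z" for Z
    using that by (rule Q.mean_count_measurable)
  have mean_int: "integrable ?R (Q.mean_count k r {z})" for z
  proof (rule R.integrable_const_bound)
    show "AE S in ?R. norm (Q.mean_count k r {z} S) \<le> Q.cell_moment"
      using AE_space by eventually_elim (simp add: space_configs Q.mean_count_le Q.mean_count_nonneg)
  qed simp
  have mean_integral: "(\<integral>S. Q.mean_count k r {z} S \<partial>?R) = L" for z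
  proof -
    let ?v = "(\<chi> i. - of_int (z $ i) / (2 * r)) :: real^'n"
    have "(\<integral>S. Q.mean_count k r {z} S \<partial>?R) = (\<integral>S. Q.mean_count k r {0} ((+) ?v ` S) \<partial>?R)"
      using Q.mean_count_shift_cell[OF _ assms(12), of _ k 0 z]
      by (intro Bochner_Integration.integral_cong) (simp_all add: space_configs)
    also have "\<dots> = (\<integral>S. Q.mean_count k r {0} S \<partial>distr ?R configs (\<lambda>S. (+) ?v ` S))"
      by (rule integral_distr[symmetric]) (simp_all add: translate_measurable)
    finally show ?thesis
      unfolding stat L_def .
  qed
  \<comment> \<open>The unit cube consists, up to a null set, of the 2^d cells indexed by
    \<open>zbox 1\<close>, each with expected count \<open>L\<close> by stationarity. The same
    factor 2^d relates the size of \<open>zbox n\<close> to n^d, which makes the two normalisations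
    agree.\<close>
  have Theta_eq: "Theta M lambda X Y1 k r = inverse lambda * (2 ^ ?d * L)"
  proof -
    have "integrable M (\<lambda>\<omega>. real (card (X \<omega> \<inter> cube 1)))"
    proof -
      have "integrable ?Q (\<lambda>A. real (card (A \<inter> cube 1)))"
        using Q.card_measurable_Q[OF cube_borel bounded_cube] Q.square_integrable[OF cube_borel bounded_cube]
        by (rule Q.square_integrable_imp_integrable)
      then show ?thesis
        by (rule integrable_distr[OF X])
    qed
    then have "integrable M (\<lambda>\<omega>. ?N 1 (X \<omega>) (Y1 \<omega>))"
    proof (rule Bochner_Integration.integrable_bound)
      show "AE \<omega> in M. norm (?N 1 (X \<omega>) (Y1 \<omega>)) \<le> norm (real (card (X \<omega> \<inter> cube 1)))"
      proof (rule AE_I2)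
        fix \<omega> assume "\<omega> \<in> space M"
        then have "loc_fin (X \<omega>)"
          using measurable_space[OF X] by (simp add: space_configs)
        then show "norm (?N 1 (X \<omega>) (Y1 \<omega>)) \<le> norm (real (card (X \<omega> \<inter> cube 1)))"
          using near_count_le_card[OF _ bounded_cube] by simp
      qed
      show "(\<lambda>\<omega>. ?N 1 (X \<omega>) (Y1 \<omega>)) \<in> borel_measurable M"
        using measurable_compose[OF measurable_Pair[OF X Y] N_meas[of 1]] by simp
    qed
    then have int: "integrable (?Q \<Otimes>\<^sub>M ?R) (\<lambda>(A, S). ?N 1 A S)"
      unfolding joint[symmetric]
      using integrable_distr_eq[OF measurable_Pair[OF X Y] N_meas[of 1]] by simp
    have "expectation (\<lambda>\<omega>. ?N 1 (X \<omega>) (Y1 \<omega>)) = (\<integral>p. (case p of (A, S) \<Rightarrow> ?N 1 A S) \<partial>(?Q \<Otimes>\<^sub>M ?R))"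
      unfolding joint[symmetric]
      using integral_distr[OF measurable_Pair[OF X Y] N_meas[of 1]] by simp
    also have "\<dots> = (\<integral>S. (\<integral>A. ?N 1 A S \<partial>?Q) \<partial>?R)"
      using int by (rule QR.integral_snd[symmetric])
    also have "\<dots> = (\<integral>S. Q.mean_count k r (zbox 1) S \<partial>?R)"
      using N_eq_cells[of _ 1] by (intro Bochner_Integration.integral_cong) (simp_all add: space_configs)
    also have "\<dots> = (\<integral>S. (\<Sum>z\<in>zbox 1. Q.mean_count k r {z} S) \<partial>?R)"
      using Q.mean_count_sum[OF finite_zbox, of _ k r 1]
      by (intro Bochner_Integration.integral_cong) (simp_all add: space_configs)
    also have "\<dots> = 2 ^ ?d * L"
      by (simp add: mean_int mean_integral card_zbox)
    finally show ?thesis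
      unfolding Theta_def hop_count_eq by simp
  qed
  have "AE p in ?Q \<Otimes>\<^sub>M ?R. (\<lambda>n. inverse lambda * inverse (real n ^ ?d) * (case p of (A, S) \<Rightarrow> ?N n A S))
      \<longlonglongrightarrow> inverse lambda * (2 ^ ?d * L)" (is "AE p in _. ?lim p")
  proof -
    \<comment> \<open>Convergence is an event for the product law because the counts are jointly
      measurable; interchanging the two almost sure quantifiers rests on this.\<close>
    have lim_sets: "{p \<in> space (?Q \<Otimes>\<^sub>M ?R). ?lim p} \<in> sets (?Q \<Otimes>\<^sub>M ?R)"
      by measurable
    have "AE S in ?R. (\<lambda>n. Q.mean_count k r (zbox n) S / real (card (zbox n :: (int^'n) set))) \<longlonglongrightarrow> L"
      unfolding L_def
    proof (rule Q.mean_count_ergodic)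
      fix E :: "(real^'n) set set" assume E: "E \<in> sets configs" "shift_invariant E"
      have "Y1 -` E \<inter> space M = {\<omega> \<in> space M. Y1 \<omega> \<in> E}" by auto
      then show "measure ?R E \<in> {0, 1}"
        using assms(7) E unfolding ergodic_def by (simp add: measure_distr)
    qed (use R.prob_space_axioms stat assms(12) in auto)
    then have "AE S in ?R. AE A in ?Q. ?lim (A, S)"
      using AE_space
    proof eventually_elim
      case (elim S)
      then have S: "loc_fin S" by (simp add: space_configs)
      show ?case
        using Q.count_law_of_large_numbers[OF S assms(2), of k r] Q.AE_near_count_cube[of k r]
      proof eventually_elim
        case (elim A)
        let ?c = "\<lambda>n. real (card (zbox n :: (int^'n) set))"
        have "(\<lambda>n. (real (near_count k r (cells (zbox n)) A S) - Q.mean_count k r (zbox n) S) / ?c n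
            + Q.mean_count k r (zbox n) S / ?c n) \<longlonglongrightarrow> 0 + L"
          by (intro tendsto_add elim(1) \<open>_ \<longlonglongrightarrow> L\<close>)
        then have "(\<lambda>n. ?N n A S / ?c n) \<longlonglongrightarrow> L"
          by (simp add: elim(2) flip: add_divide_distrib)
        \<comment> \<open>True also at n = 0, where both sides are 0 by division by zero.\<close>
        moreover have "2 ^ ?d * (?N n A S / ?c n) = inverse (real n ^ ?d) * ?N n A S" for n
          unfolding scaled_zbox_card by (simp add: field_simps)
        ultimately show ?case
          using tendsto_mult[OF tendsto_const tendsto_mult[OF tendsto_const], of "\<lambda>n. ?N n A S / ?c n" L sequentially "inverse lambda" "2 ^ ?d"]
          by (simp add: mult.assoc)
      qed
    qed
    \<comment> \<open>The argument fixes \<open>S\<close> first, whereas passing to the product law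
      expects the first factor outermost.\<close>
    then have "AE A in ?Q. AE S in ?R. ?lim (A, S)"
      using lim_sets by (subst QR.AE_commute) (simp_all add: case_prod_beta)
    then show ?thesis
      by (rule QR.AE_pair_measure[OF lim_sets])
  qed
  then have "AE \<omega> in M. (\<lambda>n. inverse lambda * inverse (real n ^ ?d) * ?N n (X \<omega>) (Y1 \<omega>))
      \<longlonglongrightarrow> inverse lambda * (2 ^ ?d * L)"
    unfolding joint[symmetric] by (subst (asm) AE_distr_iff) auto
  then show ?thesis
    unfolding Theta_eq hop_count_eq .
qed

end
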